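(* Suppose that $c>0$ and consider the boundary value problem $$\lim_{|z|\to1}\big(|g'(z)|-c\,(1+|g(z)|^2)\big)=0\qquad( * )$$ for $g\in\mathcal{H}_0(\mathbb{D})$. (a) If $c<1/2$, then $( * )$ has exactly two locally univalent solutions $g_{\pm}\in\mathcal{H}_0(\mathbb{D})$, given by $$g_{\pm}(z)=\frac{1\pm\sqrt{1-4c^2}}{2c}\,z.$$ These solutions are univalent, and they are the unique extremal functions for the extremal problems $$\max\{g'(0):g\in B_{\Phi_c}\}\quad\text{and}\quad\min\{g'(0):g\in B_{\Phi_c}\}$$ ($g_+$ for the maximum and $g_-$ for the minimum). (b) If $c=1/2$, then $g(z)=z$ is the only locally univalent solution $g\in\mathcal{H}_0(\mathbb{D})$ of $( * )$. (c) If $c>1/2$, then $( * )$ has no locally univalent solution in $\mathcal{H}_0(\mathbb{D})$.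
   Context: $\mathbb{D}=\{z\in\mathbb{C}:|z|<1\}$. $\mathcal{H}_0(\mathbb{D})$ is the set of all holomorphic functions $g:\mathbb{D}\to\mathbb{C}$ with $g(0)=0$ and $g'(0)>0$. Univalent means injective; locally univalent means injective in a neighborhood of each point of $\mathbb{D}$. For $c>0$, $\Phi_c(w)=c\,(1+|w|^2)$ for $w\in\mathbb{C}$, and $$B_{\Phi_c}=\Big\{g\in\mathcal{H}_0(\mathbb{D})\text{ univalent}:\ \liminf_{|z|\to1}\big(|g'(z)|-\Phi_c(g(z))\big)\ge0\Big\}.$$ *)

theory Defs
  imports "HOL-Complex_Analysis.Complex_Analysis"
begin

abbreviation unit_disc :: "complex set" where
  "unit_disc \<equiv> ball 0 1"

(* A function on the disc is a total function whose values off the disc are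
   irrelevant, so equality of functions on the disc is the following relation. *)
definition eq_on_disc :: "(complex \<Rightarrow> complex) \<Rightarrow> (complex \<Rightarrow> complex) \<Rightarrow> bool" where
  "eq_on_disc f g \<longleftrightarrow> (\<forall>z\<in>unit_disc. f z = g z)"

definition H0 :: "(complex \<Rightarrow> complex) set" where
  "H0 = {g. g holomorphic_on unit_disc \<and> g 0 = 0 \<and> deriv g 0 \<in> \<real> \<and> Re (deriv g 0) > 0}"

definition univalent :: "(complex \<Rightarrow> complex) \<Rightarrow> bool" where
  "univalent g \<longleftrightarrow> inj_on g unit_disc"

definition locally_univalent :: "(complex \<Rightarrow> complex) \<Rightarrow> bool" where
  "locally_univalent g \<longleftrightarrow>
     (\<forall>z\<in>unit_disc. \<exists>U. open U \<and> z \<in> U \<and> U \<subseteq> unit_disc \<and> inj_on g U)"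

(* The filter of |z| tending to 1 from inside the disc (uniformly in arg z). *)
definition to_circle :: "complex filter" where
  "to_circle = filtercomap cmod (at_left 1)"

lemma eventually_to_circle:
  "eventually P to_circle \<longleftrightarrow> (\<exists>r<1. \<forall>z. r < cmod z \<and> cmod z < 1 \<longrightarrow> P z)"
proof
  assume "eventually P to_circle"
  then obtain Q where Q: "eventually Q (at_left (1::real))" "\<And>z. Q (cmod z) \<Longrightarrow> P z"
    by (auto simp: to_circle_def eventually_filtercomap)
  from Q(1) obtain b where "b < 1" "\<forall>y>b. y < 1 \<longrightarrow> Q y"
    using eventually_at_left[of 0 "1::real" Q] by auto
  with Q(2) show "\<exists>r<1. \<forall>z. r < cmod z \<and> cmod z < 1 \<longrightarrow> P z" by blast
next
  assume "\<exists>r<1. \<forall>z. r < cmod z \<and> cmod z < 1 \<longrightarrow> P z"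
  then obtain r where r: "r < 1" "\<And>z. r < cmod z \<Longrightarrow> cmod z < 1 \<Longrightarrow> P z" by blast
  have "eventually (\<lambda>x. x \<in> {r<..<1}) (at_left (1::real))"
    using r(1) by (rule eventually_at_left_real)
  then show "eventually P to_circle"
    unfolding to_circle_def eventually_filtercomap using r(2) by force
qed

definition Phi :: "real \<Rightarrow> complex \<Rightarrow> real" where
  "Phi c w = c * (1 + (cmod w)\<^sup>2)"

(* The lower limit is taken in the extended reals, so it may be infinite. *)
definition B :: "(complex \<Rightarrow> real) \<Rightarrow> (complex \<Rightarrow> complex) set" where
  "B \<Phi> = {g \<in> H0. univalent g \<and>
            Liminf to_circle (\<lambda>z. ereal (cmod (deriv g z) - \<Phi> (g z))) \<ge> 0}"

definition solves_bvp :: "real \<Rightarrow> (complex \<Rightarrow> complex) \<Rightarrow> bool" where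
  "solves_bvp c g \<longleftrightarrow>
     ((\<lambda>z. cmod (deriv g z) - c * (1 + (cmod (g z))\<^sup>2)) \<longlongrightarrow> 0) to_circle"

definition g_plus :: "real \<Rightarrow> complex \<Rightarrow> complex" where
  "g_plus c z = complex_of_real ((1 + sqrt (1 - 4 * c\<^sup>2)) / (2 * c)) * z"

definition g_minus :: "real \<Rightarrow> complex \<Rightarrow> complex" where
  "g_minus c z = complex_of_real ((1 - sqrt (1 - 4 * c\<^sup>2)) / (2 * c)) * z"

end

theory Submission
  imports Defs
begin

text \<open>
  A locally univalent \<open>g\<close> with \<open>g 0 = 0\<close> is encoded by the pair \<open>a = 1 / sqrt g'\<close>, \<open>b = g / sqrt g'\<close>,
  holomorphic on the disc because \<open>g'\<close> has no zero there. Its Wronskian \<open>a b' - b a'\<close> is 1, and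
  \<open>\<rho> = |a|^2 + |b|^2 = (1 + |g|^2) / |g'|\<close>, so the boundary condition says that the curve
  \<open>Y = (a, b)\<close> in \<open>\<complex>^2\<close> has \<open>|Y|^2 \<rightarrow> R = 1 / c\<close> at the circle.
  Write \<open>energy n\<close> for the squared length of the \<open>n\<close>-th Taylor coefficient of \<open>Y\<close>, and \<open>t = g'(0)\<close>.
  Then \<open>energy 0 = 1 / t\<close> and \<open>energy 1 = |a'(0)|^2 + t\<close>.

  Extremal problems. For a competitor, \<open>limsup \<rho> \<le> R\<close>, and Parseval gives \<open>\<Sum> energy n \<le> R\<close>. Hence
  \<open>t + 1 / t \<le> 1 / c\<close>, which confines \<open>t\<close> to the interval between the two roots of \<open>c t^2 - t + c = 0\<close>;
  at an endpoint all other coefficients vanish and \<open>g\<close> is linear (\<open>subsolution_bound\<close>).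

  Solutions. Differentiating the Wronskian shows \<open>Y'' = l Y\<close> for a holomorphic scalar \<open>l\<close>. With
  \<open>L = z^2 l\<close>, the mean over \<open>|z| = r\<close> of \<open>\<langle>z^2 Y'', Y\<rangle> = L \<rho>\<close> is, by Parseval,
  \<open>\<Sum> n (n - 1) r^(2 n) energy n\<close>. Since \<open>L 0 = 0\<close>, the mean of \<open>R L\<close> is 0, so the sum is also the mean
  of \<open>L (\<rho> - R)\<close>. If this tends to 0 as \<open>r \<rightarrow> 1\<close>, then \<open>energy n = 0\<close> for all \<open>n \<ge> 2\<close>, \<open>Y\<close> is affine,
  and constancy of \<open>|Y|\<close> on the circle forces \<open>a\<close> to be constant. So \<open>g z = t z\<close> with
  \<open>t + 1 / t = 1 / c\<close>, and the cases of the theorem count the positive roots of this equation.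

  The work is to justify the limit, because only continuity of \<open>\<rho>\<close> at the circle is given. A barrier
  argument gives \<open>0 \<le> R - \<rho> \<le> K (1 - |z|)\<close> (\<open>\<rho>_near_boundary_value\<close>). A Schwarz estimate turns this
  into boundedness of \<open>Y'\<close> (\<open>deriv_norm_bounded\<close>), hence \<open>\<Sum> n^2 energy n < \<infinity>\<close>. Then \<open>(1 - r)^2\<close> times the
  mean of \<open>|z^2 Y''|^2\<close> tends to 0 by dominated convergence (\<open>second_deriv_mean_tendsto\<close>), and the two
  estimates combine in \<open>energy_eq_0\<close>.
\<close>

section \<open>Means over circles, Taylor coefficients and Parseval\<close>

definition circle_mean :: "real \<Rightarrow> (complex \<Rightarrow> 'a::euclidean_space) \<Rightarrow> 'a" where
  "circle_mean r f = integral {0..1} (\<lambda>t. f (of_real r * cis (2 * pi * t)))"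

lemma continuous_on_circle_param:
  fixes f :: "complex \<Rightarrow> 'a::topological_space"
  assumes "0 \<le> r" "continuous_on (sphere 0 r) f"
  shows "continuous_on {0..1} (\<lambda>t. f (of_real r * cis (2 * pi * t)))"
proof -
  have "continuous_on {0..1} (\<lambda>t. complex_of_real r * cis (2 * pi * t))"
    by (intro continuous_intros)
  then show ?thesis
    by (rule continuous_on_compose2[OF assms(2)]) (use assms(1) in \<open>auto simp: norm_mult\<close>)
qed

lemma circle_integrable:
  fixes f :: "complex \<Rightarrow> 'a::euclidean_space"
  assumes "0 \<le> r" "continuous_on (sphere 0 r) f"
  shows "(\<lambda>t. f (of_real r * cis (2 * pi * t))) integrable_on {0..1}"
  by (intro integrable_continuous_interval continuous_on_circle_param assms)

lemma circle_mean_cong: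
  assumes "0 \<le> r" "\<And>z. cmod z = r \<Longrightarrow> f z = g z"
  shows "circle_mean r f = circle_mean r g"
  unfolding circle_mean_def using assms by (intro integral_cong) (auto simp: norm_mult)

lemma circle_mean_add:
  assumes "0 \<le> r" "continuous_on (sphere 0 r) f" "continuous_on (sphere 0 r) g"
  shows "circle_mean r (\<lambda>z. f z + g z) = circle_mean r f + circle_mean r g"
  unfolding circle_mean_def by (intro integral_add circle_integrable assms)

lemma circle_mean_diff:
  assumes "0 \<le> r" "continuous_on (sphere 0 r) f" "continuous_on (sphere 0 r) g"
  shows "circle_mean r (\<lambda>z. f z - g z) = circle_mean r f - circle_mean r g"
  unfolding circle_mean_def by (intro integral_diff circle_integrable assms)

lemma circle_mean_mult_left:
  fixes k :: "'a::{real_normed_field, euclidean_space}"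
  assumes "0 \<le> r" "continuous_on (sphere 0 r) f"
  shows "circle_mean r (\<lambda>z. k * f z) = k * circle_mean r f"
  unfolding circle_mean_def
  by (intro integral_unique has_integral_mult_right integrable_integral circle_integrable assms)

lemma circle_mean_cnj:
  assumes "0 \<le> r" "continuous_on (sphere 0 r) f"
  shows "circle_mean r (\<lambda>z. cnj (f z)) = cnj (circle_mean r f)"
  unfolding circle_mean_def by (rule integral_cnj[symmetric])

lemma circle_mean_of_real:
  assumes "0 \<le> r" "continuous_on (sphere 0 r) f"
  shows "circle_mean r (\<lambda>z. complex_of_real (f z)) = of_real (circle_mean r f)"
  unfolding circle_mean_def
  using has_integral_linear[OF integrable_integral[OF circle_integrable[OF assms]] bounded_linear_of_real]
  by (auto simp: o_def intro: integral_unique)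

lemma circle_mean_const [simp]: "circle_mean r (\<lambda>z. k) = k"
  by (simp add: circle_mean_def)

lemma norm_circle_mean_le:
  assumes "0 \<le> r" "continuous_on (sphere 0 r) f" "continuous_on (sphere 0 r) g"
    and "\<And>z. cmod z = r \<Longrightarrow> norm (f z) \<le> g z"
  shows "norm (circle_mean r f) \<le> circle_mean r g"
  unfolding circle_mean_def
  by (intro integral_norm_bound_integral circle_integrable assms) (use assms in \<open>auto simp: norm_mult\<close>)

lemma circle_mean_mono:
  fixes f g :: "complex \<Rightarrow> real"
  assumes "0 \<le> r" "continuous_on (sphere 0 r) f" "continuous_on (sphere 0 r) g"
    and "\<And>z. cmod z = r \<Longrightarrow> f z \<le> g z"
  shows "circle_mean r f \<le> circle_mean r g"
  unfolding circle_mean_def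
  by (intro integral_le circle_integrable assms) (use assms in \<open>auto simp: norm_mult\<close>)

lemma circle_mean_monomial:
  assumes "0 \<le> r"
  shows "circle_mean r (\<lambda>z. z ^ m * cnj z ^ n) = (if m = n then of_real (r ^ (2 * n)) else 0)"
proof (cases "m = n")
  case True
  have "z ^ m * cnj z ^ n = of_real (r ^ (2 * n))" if "cmod z = r" for z
  proof -
    have "z ^ m * cnj z ^ n = (z * cnj z) ^ n" using True by (simp only: power_mult_distrib)
    also have "\<dots> = of_real (r ^ (2 * n))"
      using that by (simp only: complex_norm_square[symmetric] of_real_power power_mult)
    finally show ?thesis .
  qed
  then have "circle_mean r (\<lambda>z. z ^ m * cnj z ^ n) = circle_mean r (\<lambda>z. of_real (r ^ (2 * n)))"
    using assms by (intro circle_mean_cong)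
  then show ?thesis using True by simp
next
  case False
  define k :: real where "k = 2 * pi * (real m - real n)"
  have k: "k \<noteq> 0" using False by (simp add: k_def)
  have eq: "(of_real r * cis (2 * pi * t)) ^ m * cnj (of_real r * cis (2 * pi * t)) ^ n
      = of_real (r ^ (m + n)) * cis (k * t)" for t
  proof -
    have "cis (2 * pi * t) ^ m * cis (- (2 * pi * t)) ^ n = cis (k * t)"
      by (simp add: Complex.DeMoivre cis_mult k_def algebra_simps)
    then show ?thesis
      by (simp add: power_mult_distrib cis_cnj power_add mult_ac)
  qed
  have "((\<lambda>t. cis (k * t)) has_integral (cis (k * 1) / (\<i> * k) - cis (k * 0) / (\<i> * k))) {0..1}"
  proof (rule fundamental_theorem_of_calculus)
    fix t :: real
    have "((\<lambda>t. exp (\<i> * complex_of_real k * of_real t) / (\<i> * k)) has_vector_derivative exp (\<i> * complex_of_real k * of_real t)) (at t within {0..1})"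
      by (rule has_vector_derivative_real_field) (use k in \<open>auto intro!: derivative_eq_intros\<close>)
    then show "((\<lambda>t. cis (k * t) / (\<i> * k)) has_vector_derivative cis (k * t)) (at t within {0..1})"
      by (simp add: cis_conv_exp mult.assoc)
  qed simp
  moreover have "cis k = 1"
    using cis_multiple_2pi[of "real m - real n"] by (simp add: k_def)
  ultimately have "((\<lambda>t. cis (k * t)) has_integral 0) {0..1}" by simp
  then have "((\<lambda>t. of_real (r ^ (m + n)) * cis (k * t)) has_integral of_real (r ^ (m + n)) * 0) {0..1}"
    by (rule has_integral_mult_right)
  then show ?thesis using False
    unfolding circle_mean_def eq by (simp only: integral_unique mult_zero_right if_False)
qed

text \<open>A power series converges uniformly on smaller circles, so it can be integrated termwise against any
  continuous weight. Two applications, to either factor of a product, give Parseval.\<close>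

lemma circle_mean_sums:
  assumes r: "0 \<le> r" "r < 1"
    and f: "\<And>z. cmod z < 1 \<Longrightarrow> (\<lambda>n. p n * z ^ n) sums f z"
    and w: "continuous_on (sphere 0 r) w"
  shows "(\<lambda>n. circle_mean r (\<lambda>z. p n * z ^ n * w z)) sums circle_mean r (\<lambda>z. f z * w z)"
proof -
  let ?c = "\<lambda>t. of_real r * cis (2 * pi * t)"
  have "conv_radius p \<ge> 1"
  proof (rule conv_radius_geI_ex')
    fix s :: real assume "0 < s" "ereal s < 1"
    then show "summable (\<lambda>n. p n * of_real s ^ n)"
      using f[of "of_real s"] by (auto intro: sums_summable)
  qed
  then have "ereal r < conv_radius p" using r by (meson ereal_less(3) less_le_trans)
  then have "uniform_limit (cball 0 r) (\<lambda>n x. \<Sum>i<n. p i * (x - 0) ^ i)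
      (\<lambda>x. suminf (\<lambda>i. p i * (x - 0) ^ i)) sequentially"
    by (rule powser_uniform_limit)
  then have "uniform_limit (sphere 0 r) (\<lambda>n x. \<Sum>i<n. p i * x ^ i) f sequentially"
  proof (rule uniform_limit_cong[THEN iffD1, rotated 2, OF uniform_limit_on_subset])
    show "\<And>x. x \<in> sphere 0 r \<Longrightarrow> (\<Sum>i. p i * (x - 0) ^ i) = f x"
      using f r by (auto simp: sums_iff)
  qed auto
  then have ul: "uniform_limit (sphere 0 r) (\<lambda>n x. (\<Sum>i<n. p i * x ^ i)) f sequentially" .
  have "bounded (w ` sphere 0 r)"
    using w by (intro compact_imp_bounded compact_continuous_image) auto
  moreover have "continuous_on (sphere 0 r) f"
    by (rule uniform_limit_theorem[OF _ ul]) (auto intro!: continuous_intros always_eventually)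
  then have "bounded (f ` sphere 0 r)"
    by (intro compact_imp_bounded compact_continuous_image) auto
  ultimately have "uniform_limit (sphere 0 r) (\<lambda>n x. (\<Sum>i<n. p i * x ^ i) * w x) (\<lambda>x. f x * w x) sequentially"
    by (intro uniform_lim_mult ul uniform_limit_const)
  then have "uniform_limit {0..1} (\<lambda>n t. (\<Sum>i<n. p i * (?c t) ^ i) * w (?c t)) (\<lambda>t. f (?c t) * w (?c t)) sequentially"
    by (rule uniform_limit_compose') (use r in \<open>auto simp: norm_mult\<close>)
  then obtain I J where I: "\<And>n. ((\<lambda>t. (\<Sum>i<n. p i * (?c t) ^ i) * w (?c t)) has_integral I n) {0..1}"
      and J: "((\<lambda>t. f (?c t) * w (?c t)) has_integral J) {0..1}" and IJ: "I \<longlonglongrightarrow> J"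
    by (rule uniform_limit_integral)
       (use r in \<open>auto intro!: continuous_intros continuous_on_circle_param[OF _ w]\<close>)
  have "I n = (\<Sum>i<n. circle_mean r (\<lambda>z. p i * z ^ i * w z))" for n
  proof -
    have "I n = integral {0..1} (\<lambda>t. \<Sum>i<n. p i * (?c t) ^ i * w (?c t))"
      using I[of n] by (simp add: integral_unique sum_distrib_right)
    also have "\<dots> = (\<Sum>i<n. circle_mean r (\<lambda>z. p i * z ^ i * w z))"
      unfolding circle_mean_def
      by (rule integral_sum)
         (use r w in \<open>auto intro!: circle_integrable[of r "\<lambda>z. p _ * z ^ _ * w z"] continuous_intros\<close>)
    finally show ?thesis .
  qed
  then have "I = (\<lambda>n. \<Sum>i<n. circle_mean r (\<lambda>z. p i * z ^ i * w z))" by (rule ext)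
  with IJ J show ?thesis unfolding sums_def by (simp add: circle_mean_def integral_unique)
qed

lemma parseval:
  assumes r: "0 \<le> r" "r < 1"
    and f: "\<And>z. cmod z < 1 \<Longrightarrow> (\<lambda>n. p n * z ^ n) sums f z"
    and g: "\<And>z. cmod z < 1 \<Longrightarrow> (\<lambda>n. q n * z ^ n) sums g z"
    and contf: "continuous_on (sphere 0 r) f"
    and contg: "continuous_on (sphere 0 r) g"
  shows "(\<lambda>n. p n * cnj (q n) * of_real (r ^ (2 * n))) sums circle_mean r (\<lambda>z. f z * cnj (g z))"
proof -
  have coeff: "circle_mean r (\<lambda>z. g z * cnj z ^ n) = q n * of_real (r ^ (2 * n))" for n
  proof -
    have "(\<lambda>m. circle_mean r (\<lambda>z. q m * z ^ m * cnj z ^ n)) sums circle_mean r (\<lambda>z. g z * cnj z ^ n)"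
      by (rule circle_mean_sums[OF r g]) (auto intro!: continuous_intros)
    moreover have "circle_mean r (\<lambda>z. q m * z ^ m * cnj z ^ n) = (if m = n then q n * of_real (r ^ (2 * n)) else 0)" for m
    proof -
      have "circle_mean r (\<lambda>z. q m * (z ^ m * cnj z ^ n)) = q m * circle_mean r (\<lambda>z. z ^ m * cnj z ^ n)"
        using r by (intro circle_mean_mult_left) (auto intro!: continuous_intros)
      then show ?thesis using r by (simp add: circle_mean_monomial mult.assoc)
    qed
    moreover have "(\<lambda>m. if m = n then q n * of_real (r ^ (2 * n)) else 0) sums (q n * complex_of_real (r ^ (2 * n)))"
      using sums_single[of n "\<lambda>_. q n * complex_of_real (r ^ (2 * n))"] .
    ultimately show ?thesis by (simp only: sums_unique2)
  qed
  have "(\<lambda>n. circle_mean r (\<lambda>z. p n * z ^ n * cnj (g z))) sums circle_mean r (\<lambda>z. f z * cnj (g z))"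
    by (rule circle_mean_sums[OF r f]) (use contg in \<open>auto intro!: continuous_intros\<close>)
  moreover have "circle_mean r (\<lambda>z. p n * z ^ n * cnj (g z)) = p n * cnj (q n) * of_real (r ^ (2 * n))" for n
  proof -
    have "circle_mean r (\<lambda>z. p n * cnj (g z * cnj z ^ n)) = p n * circle_mean r (\<lambda>z. cnj (g z * cnj z ^ n))"
      using r contg by (intro circle_mean_mult_left) (auto intro!: continuous_intros)
    also have "\<dots> = p n * cnj (circle_mean r (\<lambda>z. g z * cnj z ^ n))"
      using r contg by (subst circle_mean_cnj) (auto intro!: continuous_intros)
    finally show ?thesis by (simp add: coeff mult_ac)
  qed
  ultimately show ?thesis by simp
qed

definition taylor :: "(complex \<Rightarrow> complex) \<Rightarrow> nat \<Rightarrow> complex" where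
  "taylor f n = (deriv ^^ n) f 0 / fact n"

lemma taylor_sums:
  assumes "f holomorphic_on unit_disc" "cmod z < 1"
  shows "(\<lambda>n. taylor f n * z ^ n) sums f z"
  using holomorphic_power_series[OF assms(1), of z] assms(2) by (simp add: taylor_def)

lemma taylor_deriv: "taylor (deriv f) n = of_nat (Suc n) * taylor f (Suc n)"
  by (simp add: taylor_def funpow_Suc_right del: funpow.simps of_nat_Suc)

lemma taylor_sums_deriv:
  assumes "f holomorphic_on unit_disc" "cmod z < 1"
  shows "(\<lambda>n. (of_nat n * taylor f n) * z ^ n) sums (z * deriv f z)"
proof -
  have "deriv f holomorphic_on unit_disc"
    using assms(1) by (rule holomorphic_deriv) simp
  from sums_mult[OF taylor_sums[OF this assms(2)], of z]
  have "(\<lambda>n. (of_nat (Suc n) * taylor f (Suc n)) * z ^ Suc n) sums (z * deriv f z)"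
    by (simp add: taylor_deriv mult_ac del: of_nat_Suc)
  from sums_Suc_imp[OF _ this] show ?thesis by simp
qed

lemma taylor_sums_deriv2:
  assumes "f holomorphic_on unit_disc" "cmod z < 1"
  shows "(\<lambda>n. (of_nat (n * (n - 1)) * taylor f n) * z ^ n) sums (z\<^sup>2 * deriv (deriv f) z)"
proof -
  have "deriv f holomorphic_on unit_disc"
    using assms(1) by (rule holomorphic_deriv) simp
  from sums_mult[OF taylor_sums_deriv[OF this assms(2)], of z]
  have "(\<lambda>n. (of_nat (Suc n * (Suc n - 1)) * taylor f (Suc n)) * z ^ Suc n) sums (z\<^sup>2 * deriv (deriv f) z)"
    by (simp add: taylor_deriv power2_eq_square mult_ac del: of_nat_Suc mult_Suc mult_Suc_right)
  from sums_Suc_imp[OF _ this] show ?thesis by simp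
qed

lemma parseval_norm:
  assumes r: "0 \<le> r" "r < 1"
    and f: "\<And>z. cmod z < 1 \<Longrightarrow> (\<lambda>n. p n * z ^ n) sums f z"
    and contf: "continuous_on (sphere 0 r) f"
  shows "(\<lambda>n. (cmod (p n))\<^sup>2 * r ^ (2 * n)) sums circle_mean r (\<lambda>z. (cmod (f z))\<^sup>2)"
proof -
  have "(\<lambda>n. complex_of_real ((cmod (p n))\<^sup>2 * r ^ (2 * n))) sums
        circle_mean r (\<lambda>z. complex_of_real ((cmod (f z))\<^sup>2))"
    using parseval[OF r f f contf contf] by (simp only: complex_norm_square of_real_mult)
  also have "circle_mean r (\<lambda>z. complex_of_real ((cmod (f z))\<^sup>2)) = of_real (circle_mean r (\<lambda>z. (cmod (f z))\<^sup>2))"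
    using r contf by (intro circle_mean_of_real) (auto intro!: continuous_intros)
  finally show ?thesis by (simp only: sums_of_real_iff)
qed

lemma circle_mean_holomorphic:
  assumes r: "0 \<le> r" "r < 1" and f: "f holomorphic_on unit_disc"
  shows "circle_mean r f = f 0"
proof -
  have "continuous_on (sphere 0 r) f"
    using r by (intro continuous_on_subset[OF holomorphic_on_imp_continuous_on[OF f]]) auto
  moreover have "(\<lambda>n. (if n = 0 then 1 else 0) * z ^ n) sums (1 :: complex)" for z
    using sums_single[of 0 "\<lambda>n. z ^ n"] by (simp add: if_distrib[of "\<lambda>x. x * _"] cong: if_cong)
  ultimately have "(\<lambda>n. taylor f n * cnj (if n = 0 then 1 else 0) * of_real (r ^ (2 * n))) sums circle_mean r (\<lambda>z. f z * cnj 1)"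
    by (intro parseval[OF r taylor_sums[OF f]]) auto
  moreover have "(\<lambda>n. taylor f n * cnj (if n = 0 then 1 else 0) * of_real (r ^ (2 * n))) sums f 0"
  proof -
    have "(\<lambda>n. taylor f n * cnj (if n = 0 then 1 else 0) * of_real (r ^ (2 * n)))
        = (\<lambda>n. if n = 0 then f 0 else 0)"
      by (auto simp: taylor_def)
    then show ?thesis using sums_single[of 0 "\<lambda>_. f 0"] by simp
  qed
  ultimately show ?thesis by (simp add: sums_iff)
qed

text \<open>The factor \<open>n r^n\<close> that a derivative brings into a Taylor coefficient is at most the geometric sum
  \<open>1 + r + \<dots> + r^(n - 1) \<le> 1 / (1 - r)\<close>.\<close>

lemma one_minus_mult_power_le:
  fixes r :: real
  assumes "0 \<le> r" "r \<le> 1"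
  shows "(1 - r) * (real n * r ^ n) \<le> 1"
proof -
  have "real n * r ^ n = (\<Sum>i<n. r ^ n)" by simp
  also have "\<dots> \<le> (\<Sum>i<n. r ^ i)"
    using assms by (intro sum_mono power_decreasing) auto
  finally have "(1 - r) * (real n * r ^ n) \<le> (1 - r) * (\<Sum>i<n. r ^ i)"
    using assms by (intro mult_left_mono) auto
  also have "\<dots> = 1 - r ^ n" by (simp add: one_diff_power_eq)
  finally show ?thesis using assms by (smt (verit) zero_le_power)
qed

text \<open>Bounds for the means over circles of radius \<open>r < 1\<close> pass to the coefficient sums at radius 1,
  because each finite partial sum is continuous in \<open>r\<close>.\<close>

lemma abel_partial_sum_le:
  fixes w :: "nat \<Rightarrow> real"
  assumes w: "\<And>n. 0 \<le> w n"
    and bd: "\<And>e. 0 < e \<Longrightarrow> eventually (\<lambda>r. \<exists>s \<le> S + e. (\<lambda>n. w n * r ^ (2 * n)) sums s) (at_left 1)"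
  shows "(\<Sum>n<N. w n) \<le> S"
proof (rule field_le_epsilon)
  fix e :: real assume "0 < e"
  from bd[OF this] have "eventually (\<lambda>r. (\<Sum>n<N. w n * r ^ (2 * n)) \<le> S + e) (at_left 1)"
    using eventually_at_left_real[of 0 1, simplified]
  proof eventually_elim
    case (elim r)
    then obtain s where s: "s \<le> S + e" "(\<lambda>n. w n * r ^ (2 * n)) sums s" by blast
    have "(\<Sum>n<N. w n * r ^ (2 * n)) \<le> s"
      using s(2) elim w sum_le_suminf[of "\<lambda>n. w n * r ^ (2 * n)" "{..<N}"] by (auto simp: sums_iff)
    with s(1) show ?case by linarith
  qed
  moreover have "((\<lambda>r. \<Sum>n<N. w n * r ^ (2 * n)) \<longlongrightarrow> (\<Sum>n<N. w n * 1 ^ (2 * n))) (at_left 1)"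
    by (intro tendsto_intros)
  ultimately show "(\<Sum>n<N. w n) \<le> S + e"
    using tendsto_upperbound[of _ _ "at_left (1::real)"] by fastforce
qed

section \<open>Holomorphic functions with positive real part\<close>

text \<open>Adding a small \<open>d > 0\<close> makes the real part strictly positive; a Cayley transform then sends the half-plane
  to the disc and the value at the centre to 0, where the Schwarz lemma applies. The gain over the
  Cauchy estimate is the factor \<open>Re (h z0)\<close>, which compensates a small radius \<open>s\<close> when \<open>h\<close> almost
  touches the boundary of the half-plane.\<close>

lemma schwarz_positive_real_part:
  assumes h: "h holomorphic_on ball z0 s" and s: "0 < s"
    and pos: "\<And>z. z \<in> ball z0 s \<Longrightarrow> 0 \<le> Re (h z)"
  shows "cmod (deriv h z0) \<le> 2 * Re (h z0) / s"
proof (rule field_le_epsilon)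
  fix e :: real assume e: "0 < e"
  define d where "d = complex_of_real (e * s / 2)"
  define w where "w = h z0 + d"
  have d: "Re d > 0" "Im d = 0" using e s by (auto simp: d_def)
  define H where "H \<zeta> = h (z0 + of_real s * \<zeta>) + d" for \<zeta>
  define \<phi> where "\<phi> \<zeta> = (H \<zeta> - w) / (H \<zeta> + cnj w)" for \<zeta>
  have H0: "H 0 = w" by (simp add: H_def w_def)
  have in_ball: "z0 + of_real s * \<zeta> \<in> ball z0 s" if "cmod \<zeta> < 1" for \<zeta>
    using that s by (simp add: dist_norm norm_mult)
  have ReH: "Re (H \<zeta>) > 0" if "cmod \<zeta> < 1" for \<zeta>
    using pos[OF in_ball[OF that]] d by (simp add: H_def)
  have Rew: "Re w > 0" using pos[of z0] s d by (simp add: w_def)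
  have nz: "H \<zeta> + cnj w \<noteq> 0" if "cmod \<zeta> < 1" for \<zeta>
    using ReH[OF that] Rew by (auto simp: complex_eq_iff)
  have holH: "H holomorphic_on ball 0 1"
  proof -
    have "h \<circ> (\<lambda>\<zeta>. z0 + of_real s * \<zeta>) holomorphic_on ball 0 1"
      by (rule holomorphic_on_compose_gen[OF _ h]) (auto intro!: holomorphic_intros in_ball simp del: mem_ball)
    then show ?thesis unfolding H_def by (auto simp: o_def intro!: holomorphic_intros)
  qed
  have \<phi>0: "\<phi> 0 = 0" by (simp add: \<phi>_def H0)
  have hol: "\<phi> holomorphic_on ball 0 1"
    unfolding \<phi>_def using nz holH by (intro holomorphic_intros) auto
  have lt: "cmod (\<phi> \<zeta>) < 1" if "cmod \<zeta> < 1" for \<zeta>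
  proof -
    have "(cmod (H \<zeta> - w))\<^sup>2 < (cmod (H \<zeta> + cnj w))\<^sup>2"
      using mult_pos_pos[OF ReH[OF that] Rew]
      unfolding cmod_power2 by (simp add: power2_eq_square algebra_simps)
    then have "cmod (H \<zeta> - w) < cmod (H \<zeta> + cnj w)"
      by (rule power_less_imp_less_base) simp
    then show ?thesis using nz[OF that] by (simp add: \<phi>_def norm_divide)
  qed
  have dh: "(h has_field_derivative deriv h z0) (at z0)"
    using h s by (meson holomorphic_derivI open_ball centre_in_ball)
  have "(H has_field_derivative deriv h z0 * of_real s) (at 0)"
  proof -
    have "((\<lambda>\<zeta>. z0 + of_real s * \<zeta>) has_field_derivative of_real s) (at 0)"
      by (auto intro!: derivative_eq_intros)
    then have "((\<lambda>\<zeta>. h (z0 + of_real s * \<zeta>)) has_field_derivative deriv h z0 * of_real s) (at 0)"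
      using DERIV_chain2[of h "deriv h z0" "\<lambda>\<zeta>. z0 + of_real s * \<zeta>" 0 "of_real s" UNIV] dh by simp
    then show ?thesis unfolding H_def by (auto intro!: derivative_eq_intros)
  qed
  then have "(\<phi> has_field_derivative (deriv h z0 * of_real s) / (w + cnj w)) (at 0)"
    unfolding \<phi>_def using nz[of 0]
    by (auto intro!: derivative_eq_intros simp: H0)
  then have "deriv \<phi> 0 = (deriv h z0 * of_real s) / (w + cnj w)"
    by (rule DERIV_imp_deriv)
  moreover have "cmod (deriv \<phi> 0) \<le> 1"
    using Schwarz_Lemma(2)[OF hol \<phi>0 lt, of 0] by simp
  ultimately have "cmod (deriv h z0 * of_real s / of_real (2 * Re w)) \<le> 1"
    by (simp only: complex_add_cnj)
  then have "cmod (deriv h z0) * s \<le> 2 * Re w"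
    using Rew s unfolding norm_divide norm_mult norm_of_real by simp
  then show "cmod (deriv h z0) \<le> 2 * Re (h z0) / s + e"
    using s by (simp add: w_def d_def field_simps)
qed

section \<open>The boundary filter\<close>

lemma filterlim_radius_to_circle:
  assumes "cmod u = 1"
  shows "filterlim (\<lambda>r. of_real r * u) to_circle (at_left 1)"
  unfolding to_circle_def filterlim_filtercomap_iff
proof -
  have "eventually (\<lambda>r::real. r \<in> {0<..<1}) (at_left 1)"
    using eventually_at_left_real[of 0 1] by simp
  then have "eventually (\<lambda>r. (cmod \<circ> (\<lambda>r. of_real r * u)) r = r) (at_left 1)"
    by (rule eventually_mono) (simp add: norm_mult assms)
  then show "filterlim (cmod \<circ> (\<lambda>r. of_real r * u)) (at_left 1) (at_left 1)"
    by (subst filterlim_cong[OF refl refl]) (auto simp: filterlim_ident)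
qed

lemma to_circle_neq_bot: "to_circle \<noteq> bot"
proof -
  have "\<exists>z. r < cmod z \<and> cmod z < 1" if "r < 1" for r
    using that dense[of "max 0 r" 1] by (metis less_max_iff_disj max_less_iff_conj norm_of_real abs_of_pos zero_less_one)
  then show ?thesis by (auto simp: trivial_limit_def eventually_to_circle)
qed

lemma norm_tendsto_to_circle: "(cmod \<longlongrightarrow> 1) to_circle"
  unfolding to_circle_def
  by (rule filterlim_mono[OF filterlim_filtercomap _ order_refl]) (simp add: at_within_le_nhds)

section \<open>Pairs with unit Wronskian: the modulus near the boundary\<close>

text \<open>In \<open>\<complex>^2\<close> the inner product with a vector and the determinant against it are the two coordinates along
  an orthogonal frame. With \<open>(p, q) = (a', b')\<close> the determinant becomes the Wronskian.\<close>

lemma lagrange_identity: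
  fixes a b p q :: complex
  shows "(cmod (p * cnj a + q * cnj b))\<^sup>2 + (cmod (a * q - b * p))\<^sup>2
    = ((cmod a)\<^sup>2 + (cmod b)\<^sup>2) * ((cmod p)\<^sup>2 + (cmod q)\<^sup>2)"
  unfolding cmod_power2 by (simp add: power2_eq_square algebra_simps)

locale unit_wronskian_pair =
  fixes a b :: "complex \<Rightarrow> complex"
  assumes hol_a: "a holomorphic_on unit_disc"
    and hol_b: "b holomorphic_on unit_disc"
    and wronskian: "z \<in> unit_disc \<Longrightarrow> a z * deriv b z - b z * deriv a z = 1"
begin

definition \<rho> :: "complex \<Rightarrow> real" where
  "\<rho> z = (cmod (a z))\<^sup>2 + (cmod (b z))\<^sup>2"

lemma \<rho>_pos: "z \<in> unit_disc \<Longrightarrow> 0 < \<rho> z"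
  using wronskian[of z] unfolding \<rho>_def
  by (metis (no_types, lifting) add_nonneg_eq_0_iff diff_zero mult_zero_left norm_eq_zero
      not_less_iff_gr_or_eq order_le_less power_eq_0_iff zero_le_power2 zero_neq_one add_nonneg_nonneg)

lemma continuous_\<rho>: "continuous_on unit_disc \<rho>"
  unfolding \<rho>_def
  using hol_a hol_b by (intro continuous_intros) (auto intro: holomorphic_on_imp_continuous_on)

lemma inner_le: "(cmod (p * cnj (a z) + q * cnj (b z)))\<^sup>2 \<le> \<rho> z * ((cmod p)\<^sup>2 + (cmod q)\<^sup>2)"
  unfolding \<rho>_def lagrange_identity[of p "a z" q "b z", symmetric] by simp

lemma inner_self: "a z * cnj (a z) + b z * cnj (b z) = of_real (\<rho> z)"
  unfolding \<rho>_def by (simp only: complex_norm_square of_real_add)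

text \<open>The inner product of \<open>(a, b)\<close> with its value at \<open>z0\<close> is holomorphic, equals \<open>\<rho> z0\<close> at \<open>z0\<close>, and has modulus
  at most \<open>sqrt (\<rho> z0 * \<rho> z)\<close> at \<open>z\<close>; the maximum modulus principle applies to it.\<close>

lemma \<rho>_le_of_boundary:
  assumes bd: "\<And>e. 0 < e \<Longrightarrow> eventually (\<lambda>z. \<rho> z < R + e) to_circle" and z0: "z0 \<in> unit_disc"
  shows "\<rho> z0 \<le> R"
proof (rule field_le_epsilon)
  fix e :: real assume "0 < e"
  then obtain r where r: "r < 1" "\<And>z. r < cmod z \<Longrightarrow> cmod z < 1 \<Longrightarrow> \<rho> z < R + e"
    using bd unfolding eventually_to_circle by blast
  obtain s where s: "max r (cmod z0) < s" "s < 1"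
    using dense[of "max r (cmod z0)" 1] r(1) z0 by auto
  then have s0: "0 < s" using norm_ge_zero[of z0] by linarith
  let ?f = "\<lambda>z. a z * cnj (a z0) + b z * cnj (b z0)"
  have sub: "cball 0 s \<subseteq> unit_disc" using s by auto
  have hol: "?f holomorphic_on unit_disc"
    by (intro holomorphic_intros hol_a hol_b)
  have "cmod (?f z0) \<le> sqrt (\<rho> z0 * (R + e))"
  proof (rule maximum_modulus_frontier[where f = ?f and S = "ball 0 s" and \<xi> = z0])
    show "?f holomorphic_on interior (ball 0 s)"
      using sub by (intro holomorphic_on_subset[OF hol]) auto
    show "continuous_on (closure (ball 0 s)) ?f"
      using sub s0 by (intro continuous_on_subset[OF holomorphic_on_imp_continuous_on[OF hol]]) auto
    show "cmod (?f z) \<le> sqrt (\<rho> z0 * (R + e))" if "z \<in> frontier (ball 0 s)" for z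
    proof -
      have "cmod z = s" using that s0 by auto
      then have "\<rho> z < R + e" using r(2) s by auto
      then have "\<rho> z0 * \<rho> z \<le> \<rho> z0 * (R + e)" using \<rho>_pos[OF z0] by simp
      moreover have "(cmod (?f z))\<^sup>2 \<le> \<rho> z0 * \<rho> z"
        using inner_le[of "a z" z0 "b z"] by (simp add: \<rho>_def)
      ultimately show ?thesis by (intro real_le_rsqrt) linarith
    qed
  qed (use s in auto)
  then have "\<rho> z0 \<le> sqrt (\<rho> z0 * (R + e))"
    using \<rho>_pos[OF z0] by (simp add: inner_self)
  then have "(\<rho> z0)\<^sup>2 \<le> \<rho> z0 * (R + e)"
    using \<rho>_pos[OF z0] real_le_lsqrt real_sqrt_le_iff
    by (smt (verit) real_sqrt_pow2_iff power_mono real_sqrt_le_0_iff sqrt_le_D)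
  then show "\<rho> z0 \<le> R + e" using \<rho>_pos[OF z0] by (simp add: power2_eq_square)
qed

text \<open>The function \<open>- ln \<rho> + C |z|^2\<close> is strictly subharmonic where \<open>C > 1 / \<rho>^2\<close>, since \<open>- ln \<rho>\<close> has
  Laplacian \<open>- 4 / \<rho>^2\<close>; so it has no interior maximum. The proof replaces second derivatives by
  holomorphic functions. Split \<open>(a, b)\<close> into the component \<open>F\<close> along its value at \<open>z0\<close> and the
  orthogonal component \<open>K\<close>, both normalised and multiplied by an exponential \<open>E\<close> that absorbs the linear
  part of \<open>C |z|^2\<close>. Minimality at \<open>z0\<close> gives \<open>|F|^2 + |K|^2 \<ge> 1 + C |z - z0|^2\<close>. But \<open>K\<close> vanishes at \<open>z0\<close>
  with derivative \<open>1 / \<rho> z0\<close>, by the Wronskian, so \<open>|F| > 1\<close> in a punctured neighbourhood of \<open>z0\<close>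
  whereas \<open>F z0 = 1\<close>, against the maximum modulus principle for \<open>1 / F\<close>.\<close>

lemma no_interior_min:
  assumes z0: "z0 \<in> unit_disc" and C: "1 < C * (\<rho> z0)\<^sup>2"
    and min: "\<And>z. z \<in> unit_disc \<Longrightarrow> \<rho> z0 * exp (- C * (cmod z0)\<^sup>2) \<le> \<rho> z * exp (- C * (cmod z)\<^sup>2)"
  shows False
proof -
  let ?\<rho>0 = "complex_of_real (\<rho> z0)"
  define E where "E z = exp (- of_real C * cnj z0 * (z - z0))" for z
  define F where "F z = (a z * cnj (a z0) + b z * cnj (b z0)) / ?\<rho>0 * E z" for z
  define K where "K z = (a z0 * b z - b z0 * a z) / ?\<rho>0 * E z" for z
  have \<rho>0: "0 < \<rho> z0" by (rule \<rho>_pos[OF z0])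
  have normE: "(cmod (E z))\<^sup>2 = exp (C * (cmod z0)\<^sup>2 - C * (cmod z)\<^sup>2 + C * (cmod (z - z0))\<^sup>2)" for z
  proof -
    have "(cmod (E z))\<^sup>2 = exp (2 * Re (- of_real C * cnj z0 * (z - z0)))"
      unfolding E_def norm_exp_eq_Re exp_double ..
    also have "2 * Re (- of_real C * cnj z0 * (z - z0)) = C * (cmod z0)\<^sup>2 - C * (cmod z)\<^sup>2 + C * (cmod (z - z0))\<^sup>2"
      unfolding cmod_power2 by (simp add: power2_eq_square algebra_simps)
    finally show ?thesis .
  qed
  have FK: "1 + C * (cmod (z - z0))\<^sup>2 \<le> (cmod (F z))\<^sup>2 + (cmod (K z))\<^sup>2" if "z \<in> unit_disc" for z
  proof -
    have scaled: "(cmod (w / ?\<rho>0 * E z))\<^sup>2 = (cmod w)\<^sup>2 / (\<rho> z0)\<^sup>2 * (cmod (E z))\<^sup>2" for w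
      by (simp add: norm_mult norm_divide power_mult_distrib power_divide)
    have "(cmod (F z))\<^sup>2 + (cmod (K z))\<^sup>2
        = ((cmod (a z * cnj (a z0) + b z * cnj (b z0)))\<^sup>2 + (cmod (a z0 * b z - b z0 * a z))\<^sup>2) / (\<rho> z0)\<^sup>2 * (cmod (E z))\<^sup>2"
      unfolding F_def K_def scaled by (simp only: add_divide_distrib distrib_right)
    also have "\<dots> = \<rho> z / \<rho> z0 * (cmod (E z))\<^sup>2"
      unfolding lagrange_identity \<rho>_def[symmetric] using \<rho>0 by (simp add: power2_eq_square)
    also have "\<dots> = (\<rho> z * exp (- C * (cmod z)\<^sup>2)) / (\<rho> z0 * exp (- C * (cmod z0)\<^sup>2)) * exp (C * (cmod (z - z0))\<^sup>2)"
      using \<rho>0 by (simp add: normE exp_add exp_diff exp_minus field_simps)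
    also have "\<dots> \<ge> 1 * exp (C * (cmod (z - z0))\<^sup>2)"
      using min[OF that] \<rho>0 by (intro mult_right_mono) simp_all
    moreover have "1 + C * (cmod (z - z0))\<^sup>2 \<le> exp (C * (cmod (z - z0))\<^sup>2)"
      by (rule exp_ge_add_one_self)
    ultimately show ?thesis by linarith
  qed
  have da: "(a has_field_derivative deriv a z0) (at z0)" and db: "(b has_field_derivative deriv b z0) (at z0)"
    using hol_a hol_b z0 by (auto intro: holomorphic_derivI)
  have "(K has_field_derivative (a z0 * deriv b z0 - b z0 * deriv a z0) / ?\<rho>0) (at z0)"
    unfolding K_def E_def using \<rho>0
    by (auto intro!: derivative_eq_intros da db simp: field_simps)
  then have "((\<lambda>z. (K z - K z0) / (z - z0)) \<longlongrightarrow> 1 / ?\<rho>0) (at z0)"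
    using wronskian[OF z0] by (simp add: has_field_derivative_iff)
  moreover have "K z0 = 0" by (simp add: K_def)
  ultimately have "((\<lambda>z. K z / (z - z0)) \<longlongrightarrow> 1 / ?\<rho>0) (at z0)" by simp
  then have "((\<lambda>z. (cmod (K z / (z - z0)))\<^sup>2) \<longlongrightarrow> (cmod (1 / ?\<rho>0))\<^sup>2) (at z0)"
    by (intro tendsto_power tendsto_norm)
  moreover have "(cmod (1 / ?\<rho>0))\<^sup>2 < C"
    using C \<rho>0 by (simp add: norm_divide field_simps)
  ultimately have "eventually (\<lambda>z. (cmod (K z / (z - z0)))\<^sup>2 < C) (at z0)"
    by (rule order_tendstoD)
  then obtain d where d: "0 < d" "\<And>z. z \<noteq> z0 \<Longrightarrow> dist z z0 < d \<Longrightarrow> (cmod (K z / (z - z0)))\<^sup>2 < C"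
    unfolding eventually_at by auto
  obtain e where e: "0 < e" "ball z0 e \<subseteq> unit_disc"
    using z0 openE[of unit_disc z0] by blast
  define S where "S = ball z0 (min d e)"
  have S: "S \<subseteq> unit_disc" "z0 \<in> S" "open S" "connected S" using d e by (auto simp: S_def)
  have F0: "F z0 = 1"
    using \<rho>0 by (simp add: F_def E_def inner_self)
  have F_gt: "1 < (cmod (F z))\<^sup>2" if "z \<in> S" "z \<noteq> z0" for z
  proof -
    have "(cmod (K z))\<^sup>2 < C * (cmod (z - z0))\<^sup>2"
      using d(2)[of z] that by (simp add: S_def dist_commute norm_divide power_divide field_simps)
    then show ?thesis using FK[of z] that S by fastforce
  qed
  have F_ge: "1 \<le> cmod (F z)" if "z \<in> S" for z
    using F_gt[OF that] F0 power2_less_imp_less[of 1 "cmod (F z)"] by (cases "z = z0") auto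
  have "F holomorphic_on S"
    unfolding F_def E_def using hol_a hol_b S \<rho>0
    by (intro holomorphic_intros) (auto intro: holomorphic_on_subset)
  then have "(\<lambda>z. 1 / F z) holomorphic_on S"
    using F_ge by (intro holomorphic_intros) fastforce+
  moreover have "cmod (1 / F z) \<le> cmod (1 / F z0)" if "z \<in> S" for z
    using F_ge[OF that] order_less_le_trans[OF zero_less_one F_ge[OF that]] by (simp add: F0 norm_divide)
  ultimately have "(\<lambda>z. 1 / F z) constant_on S"
    using S maximum_modulus_principle[of "\<lambda>z. 1 / F z" S S z0] by auto
  then obtain k where k: "\<And>z. z \<in> S \<Longrightarrow> 1 / F z = k" by (auto simp: constant_on_def)
  define z1 where "z1 = z0 + of_real (min d e / 2)"
  have z1: "z1 \<in> S" "z1 \<noteq> z0" using d e by (auto simp: z1_def S_def dist_norm)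
  have "F z1 = 1" using k[OF z1(1)] k[OF S(2)] F0 by simp
  then show False using F_gt[OF z1] by simp
qed

lemma \<rho>_bounded_below:
  assumes lim: "(\<rho> \<longlongrightarrow> R) to_circle" and R: "0 < R"
  obtains m where "0 < m" "\<And>z. z \<in> unit_disc \<Longrightarrow> m \<le> \<rho> z"
proof -
  have "eventually (\<lambda>z. R / 2 < \<rho> z) to_circle"
    using order_tendstoD(1)[OF lim, of "R/2"] R by simp
  then obtain r where r: "r < 1" "\<And>z. r < cmod z \<Longrightarrow> cmod z < 1 \<Longrightarrow> R / 2 < \<rho> z"
    unfolding eventually_to_circle by blast
  have "continuous_on (cball 0 (max 0 r)) \<rho>"
    using r(1) by (intro continuous_on_subset[OF continuous_\<rho>]) auto
  then obtain w where w: "w \<in> cball 0 (max 0 r)" "\<And>z. z \<in> cball 0 (max 0 r) \<Longrightarrow> \<rho> w \<le> \<rho> z"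
    using continuous_attains_inf[of "cball 0 (max 0 r)" \<rho>] by (metis cball_eq_empty compact_cball max.cobounded1 not_le)
  show thesis
  proof
    show "0 < min (R / 2) (\<rho> w)" using R \<rho>_pos[of w] w(1) r(1) by auto
    show "min (R / 2) (\<rho> w) \<le> \<rho> z" if "z \<in> unit_disc" for z
    proof (cases "cmod z \<le> max 0 r")
      case False
      then have "r < cmod z" by (auto simp: not_le)
      then show ?thesis using r(2)[of z] that by simp
    next
      case True
      then show ?thesis using w(2)[of z] by auto
    qed
  qed
qed

text \<open>If the inequality failed somewhere, \<open>\<rho> exp (- C |z|^2)\<close> would fall below its boundary limit and
  would therefore attain its minimum over the open disc.\<close>

lemma \<rho>_ge_barrier:
  assumes lim: "(\<rho> \<longlongrightarrow> R) to_circle"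
    and C: "\<And>z. z \<in> unit_disc \<Longrightarrow> 1 < C * (\<rho> z)\<^sup>2"
    and z1: "z1 \<in> unit_disc"
  shows "R * exp (- C) \<le> \<rho> z1 * exp (- C * (cmod z1)\<^sup>2)"
proof (rule ccontr)
  let ?w = "\<lambda>z. \<rho> z * exp (- C * (cmod z)\<^sup>2)"
  assume "\<not> ?thesis"
  then have less: "?w z1 < R * exp (- C)" by simp
  have "(?w \<longlongrightarrow> R * exp (- C * 1\<^sup>2)) to_circle"
    by (intro tendsto_intros lim norm_tendsto_to_circle)
  then have "eventually (\<lambda>z. ?w z1 < ?w z) to_circle"
    using order_tendstoD(1) less by fastforce
  then obtain r where r: "r < 1" "\<And>z. r < cmod z \<Longrightarrow> cmod z < 1 \<Longrightarrow> ?w z1 < ?w z"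
    unfolding eventually_to_circle by blast
  define s where "s = max r (cmod z1)"
  have s: "s < 1" "z1 \<in> cball 0 s" using r z1 by (auto simp: s_def)
  have "continuous_on (cball 0 s) ?w"
    using s by (intro continuous_intros continuous_on_subset[OF continuous_\<rho>]) auto
  then obtain z0 where z0: "z0 \<in> cball 0 s" "\<And>z. z \<in> cball 0 s \<Longrightarrow> ?w z0 \<le> ?w z"
    using continuous_attains_inf[of "cball 0 s" ?w] s by (metis compact_cball empty_iff)
  have "?w z0 \<le> ?w z" if "z \<in> unit_disc" for z
  proof (cases "cmod z \<le> s")
    case False
    then have "?w z1 < ?w z" using r(2)[of z] that by (simp add: s_def)
    then show ?thesis using z0(2)[OF s(2)] by linarith
  qed (use z0 in simp)
  then show False
    using no_interior_min[of z0 C] C[of z0] z0(1) s(1) by fastforce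
qed

text \<open>Mere continuity of \<open>\<rho>\<close> at the circle improves to a Lipschitz bound, uniform in the direction.\<close>

lemma \<rho>_near_boundary_value:
  assumes lim: "(\<rho> \<longlongrightarrow> R) to_circle" and R: "0 < R"
  obtains L where "0 < L" "\<And>z. z \<in> unit_disc \<Longrightarrow> \<rho> z \<le> R" "\<And>z. z \<in> unit_disc \<Longrightarrow> R - \<rho> z \<le> L * (1 - cmod z)"
proof -
  obtain m where m: "0 < m" "\<And>z. z \<in> unit_disc \<Longrightarrow> m \<le> \<rho> z"
    using \<rho>_bounded_below[OF assms] by blast
  (* Any constant above \<open>1 / m^2\<close> makes the barrier strict. *)
  define C where "C = 2 / m\<^sup>2"
  have C0: "0 < C" using m by (simp add: C_def)
  have C: "1 < C * (\<rho> z)\<^sup>2" if "z \<in> unit_disc" for z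
  proof -
    have "C * m\<^sup>2 \<le> C * (\<rho> z)\<^sup>2"
      using m that C0 by (intro mult_left_mono power_mono) auto
    moreover have "C * m\<^sup>2 = 2" using m by (simp add: C_def)
    ultimately show ?thesis by simp
  qed
  show thesis
  proof
    show "0 < 2 * R * C" using R C0 by simp
    show "\<rho> z \<le> R" if "z \<in> unit_disc" for z
      by (rule \<rho>_le_of_boundary[OF _ that]) (use order_tendstoD(2)[OF lim] in simp)
    show "R - \<rho> z \<le> 2 * R * C * (1 - cmod z)" if z: "z \<in> unit_disc" for z
    proof -
      have "R * exp (- C) * exp (C * (cmod z)\<^sup>2) \<le> \<rho> z * exp (- C * (cmod z)\<^sup>2) * exp (C * (cmod z)\<^sup>2)"
        by (intro mult_right_mono \<rho>_ge_barrier[OF lim C z]) auto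
      then have "R * exp (- (C * (1 - (cmod z)\<^sup>2))) \<le> \<rho> z"
        by (simp add: mult.assoc exp_add[symmetric] algebra_simps)
      moreover have "1 + - (C * (1 - (cmod z)\<^sup>2)) \<le> exp (- (C * (1 - (cmod z)\<^sup>2)))"
        by (rule exp_ge_add_one_self)
      then have "R * (1 + - (C * (1 - (cmod z)\<^sup>2))) \<le> R * exp (- (C * (1 - (cmod z)\<^sup>2)))"
        using R by (intro mult_left_mono) auto
      moreover have "(1 - cmod z) * (1 + cmod z) \<le> (1 - cmod z) * 2"
        using z by (intro mult_left_mono) auto
      then have "R * C * (1 - (cmod z)\<^sup>2) \<le> R * C * (2 * (1 - cmod z))"
        using R C0 by (intro mult_left_mono) (auto simp: power2_eq_square algebra_simps)
      ultimately show ?thesis by (simp add: algebra_simps)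
    qed
  qed
qed

text \<open>By the Lagrange identity and the Wronskian, \<open>\<rho> (|a'|^2 + |b'|^2)\<close> exceeds the squared inner product
  of \<open>(a', b')\<close> with \<open>(a, b)\<close> by exactly 1, so only this inner product needs a bound. At \<open>z0\<close> it is the derivative of the inner product
  of \<open>(a, b)\<close> with the fixed vector \<open>(a z0, b z0)\<close>. That function has modulus at most \<open>sqrt (R \<rho>(z0))\<close> and comes within
  \<open>O(1 - |z0|)\<close> of it at \<open>z0\<close>, so the Schwarz estimate on the ball of radius \<open>1 - |z0|\<close> gives a bound independent of \<open>z0\<close>.\<close>

lemma deriv_norm_bounded:
  assumes lim: "(\<rho> \<longlongrightarrow> R) to_circle" and R: "0 < R"
  obtains B where "\<And>z. z \<in> unit_disc \<Longrightarrow> (cmod (deriv a z))\<^sup>2 + (cmod (deriv b z))\<^sup>2 \<le> B"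
proof -
  obtain L where L: "0 < L" "\<And>z. z \<in> unit_disc \<Longrightarrow> \<rho> z \<le> R" "\<And>z. z \<in> unit_disc \<Longrightarrow> R - \<rho> z \<le> L * (1 - cmod z)"
    using \<rho>_near_boundary_value[OF assms] by blast
  obtain m where m: "0 < m" "\<And>z. z \<in> unit_disc \<Longrightarrow> m \<le> \<rho> z"
    using \<rho>_bounded_below[OF assms] by blast
  show thesis
  proof
    fix z0 assume z0: "z0 \<in> unit_disc"
    let ?f = "\<lambda>z. a z * cnj (a z0) + b z * cnj (b z0)"
    let ?h = "\<lambda>z. of_real (sqrt (R * \<rho> z0)) - ?f z"
    let ?s = "1 - cmod z0"
    let ?D = "deriv a z0 * cnj (a z0) + deriv b z0 * cnj (b z0)"
    have s: "0 < ?s" using z0 by simp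
    have sub: "ball z0 ?s \<subseteq> unit_disc" by (simp add: ball_subset_ball_iff)
    have hol: "?h holomorphic_on ball z0 ?s"
      using hol_a hol_b sub by (intro holomorphic_intros) (auto intro: holomorphic_on_subset)
    have pos: "0 \<le> Re (?h z)" if "z \<in> ball z0 ?s" for z
    proof -
      have "\<rho> z \<le> R" using L(2) that sub by blast
      then have "\<rho> z0 * \<rho> z \<le> R * \<rho> z0" using \<rho>_pos[OF z0] by simp
      moreover have "(cmod (?f z))\<^sup>2 \<le> \<rho> z0 * \<rho> z"
        using inner_le[of "a z" z0 "b z"] by (simp add: \<rho>_def)
      ultimately have "cmod (?f z) \<le> sqrt (R * \<rho> z0)" by (intro real_le_rsqrt) linarith
      then show ?thesis using complex_Re_le_cmod[of "?f z"] by simp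
    qed
    have da: "(a has_field_derivative deriv a z0) (at z0)" and db: "(b has_field_derivative deriv b z0) (at z0)"
      using hol_a hol_b z0 by (auto intro: holomorphic_derivI)
    have "deriv ?h z0 = - ?D"
      by (rule DERIV_imp_deriv) (auto intro!: derivative_eq_intros da db)
    then have "cmod (deriv ?h z0) = cmod ?D" by (simp only: norm_minus_cancel)
    moreover have "Re (?h z0) = sqrt (R * \<rho> z0) - \<rho> z0" by (simp only: inner_self) simp
    ultimately have D: "cmod ?D \<le> 2 * (sqrt (R * \<rho> z0) - \<rho> z0) / ?s"
      using schwarz_positive_real_part[OF hol s pos] by (simp only:)
    have "sqrt (R * \<rho> z0) \<le> R"
      using L(2)[OF z0] R by (intro real_le_lsqrt) (auto simp: power2_eq_square)
    then have "sqrt (R * \<rho> z0) - \<rho> z0 \<le> R - \<rho> z0" by simp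
    also have "\<dots> \<le> L * ?s" by (rule L(3)[OF z0])
    finally have "2 * (sqrt (R * \<rho> z0) - \<rho> z0) / ?s \<le> 2 * L"
      using s unfolding pos_divide_le_eq[OF s] mult.assoc by (intro mult_left_mono) simp_all
    then have "cmod ?D \<le> 2 * L" using D by linarith
    then have "(cmod ?D)\<^sup>2 \<le> (2 * L)\<^sup>2" by (rule power_mono) simp
    moreover have "(cmod ?D)\<^sup>2 + 1 = \<rho> z0 * ((cmod (deriv a z0))\<^sup>2 + (cmod (deriv b z0))\<^sup>2)"
      using lagrange_identity[of "deriv a z0" "a z0" "deriv b z0" "b z0"] wronskian[OF z0] by (simp add: \<rho>_def)
    moreover have "m * ((cmod (deriv a z0))\<^sup>2 + (cmod (deriv b z0))\<^sup>2) \<le> \<rho> z0 * ((cmod (deriv a z0))\<^sup>2 + (cmod (deriv b z0))\<^sup>2)"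
      by (intro mult_right_mono m z0) simp
    ultimately have "m * ((cmod (deriv a z0))\<^sup>2 + (cmod (deriv b z0))\<^sup>2) \<le> (2 * L)\<^sup>2 + 1" by linarith
    then show "(cmod (deriv a z0))\<^sup>2 + (cmod (deriv b z0))\<^sup>2 \<le> ((2 * L)\<^sup>2 + 1) / m"
      using m(1) by (simp add: field_simps)
  qed
qed

end

section \<open>Rigidity of the Taylor coefficients\<close>

context unit_wronskian_pair
begin

definition energy :: "nat \<Rightarrow> real" where
  "energy n = (cmod (taylor a n))\<^sup>2 + (cmod (taylor b n))\<^sup>2"

lemma energy_nonneg: "0 \<le> energy n" by (simp add: energy_def)

lemma continuous_on_circle:
  assumes "f holomorphic_on unit_disc" "r < 1"
  shows "continuous_on (sphere 0 r) f"
  using assms(2) by (intro continuous_on_subset[OF holomorphic_on_imp_continuous_on[OF assms(1)]]) auto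

lemma hol_deriv [simp]: "f holomorphic_on unit_disc \<Longrightarrow> deriv f holomorphic_on unit_disc"
  by (rule holomorphic_deriv) auto

lemma energy_sums_gen:
  assumes r: "0 \<le> r" "r < 1"
    and f: "\<And>z. cmod z < 1 \<Longrightarrow> (\<lambda>n. (of_nat (k n) * taylor a n) * z ^ n) sums f z" "continuous_on (sphere 0 r) f"
    and g: "\<And>z. cmod z < 1 \<Longrightarrow> (\<lambda>n. (of_nat (k n) * taylor b n) * z ^ n) sums g z" "continuous_on (sphere 0 r) g"
  shows "(\<lambda>n. (real (k n))\<^sup>2 * energy n * r ^ (2 * n)) sums circle_mean r (\<lambda>z. (cmod (f z))\<^sup>2 + (cmod (g z))\<^sup>2)"
proof -
  have "(\<lambda>n. (cmod (of_nat (k n) * taylor a n))\<^sup>2 * r ^ (2 * n) + (cmod (of_nat (k n) * taylor b n))\<^sup>2 * r ^ (2 * n))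
      sums (circle_mean r (\<lambda>z. (cmod (f z))\<^sup>2) + circle_mean r (\<lambda>z. (cmod (g z))\<^sup>2))"
    by (intro sums_add parseval_norm r f g)
  also have "circle_mean r (\<lambda>z. (cmod (f z))\<^sup>2) + circle_mean r (\<lambda>z. (cmod (g z))\<^sup>2) = circle_mean r (\<lambda>z. (cmod (f z))\<^sup>2 + (cmod (g z))\<^sup>2)"
    using r f(2) g(2) by (intro circle_mean_add[symmetric]) (auto intro!: continuous_intros)
  also have "(\<lambda>n. (cmod (of_nat (k n) * taylor a n))\<^sup>2 * r ^ (2 * n) + (cmod (of_nat (k n) * taylor b n))\<^sup>2 * r ^ (2 * n))
      = (\<lambda>n. (real (k n))\<^sup>2 * energy n * r ^ (2 * n))"
    by (simp add: energy_def norm_mult power_mult_distrib algebra_simps)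
  finally show ?thesis .
qed

lemma energy_sums:
  assumes "0 \<le> r" "r < 1"
  shows "(\<lambda>n. energy n * r ^ (2 * n)) sums circle_mean r \<rho>"
  using energy_sums_gen[OF assms, of "\<lambda>_. 1" a b] taylor_sums[OF hol_a] taylor_sums[OF hol_b]
    continuous_on_circle[OF hol_a assms(2)] continuous_on_circle[OF hol_b assms(2)]
  by (simp add: \<rho>_def[abs_def])

lemma energy_partial_sum_le:
  assumes bd: "\<And>e. 0 < e \<Longrightarrow> eventually (\<lambda>z. \<rho> z < R + e) to_circle"
  shows "(\<Sum>n<N. energy n) \<le> R"
proof (rule abel_partial_sum_le[OF energy_nonneg])
  fix e :: real assume "0 < e"
  show "eventually (\<lambda>r. \<exists>s \<le> R + e. (\<lambda>n. energy n * r ^ (2 * n)) sums s) (at_left 1)"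
    using eventually_at_left_real[of 0 1, simplified]
  proof eventually_elim
    case (elim r)
    then have r: "0 \<le> r" "r < 1" by auto
    have "circle_mean r \<rho> \<le> circle_mean r (\<lambda>z. R + e)"
      using r \<rho>_le_of_boundary[OF bd] \<open>0 < e\<close>
      by (intro circle_mean_mono continuous_on_subset[OF continuous_\<rho>] continuous_on_const) fastforce+
    then show ?case using energy_sums[OF r] by auto
  qed
qed

lemma summable_square_weighted_energy:
  assumes lim: "(\<rho> \<longlongrightarrow> R) to_circle" and R: "0 < R"
  shows "summable (\<lambda>n. (real n)\<^sup>2 * energy n)"
proof -
  obtain B where B: "\<And>z. z \<in> unit_disc \<Longrightarrow> (cmod (deriv a z))\<^sup>2 + (cmod (deriv b z))\<^sup>2 \<le> B"
    using deriv_norm_bounded[OF assms] by blast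
  have "0 \<le> (cmod (deriv a 0))\<^sup>2 + (cmod (deriv b 0))\<^sup>2" by simp
  also have "\<dots> \<le> B" by (rule B) simp
  finally have B0: "0 \<le> B" .
  have "(\<Sum>n<N. (real n)\<^sup>2 * energy n) \<le> B" for N
  proof (rule abel_partial_sum_le)
    fix e :: real assume e: "0 < e"
    show "eventually (\<lambda>r. \<exists>s \<le> B + e. (\<lambda>n. (real n)\<^sup>2 * energy n * r ^ (2 * n)) sums s) (at_left 1)"
      using eventually_at_left_real[of 0 1, simplified]
    proof eventually_elim
      case (elim r)
      then have r: "0 \<le> r" "r < 1" by auto
      have cont: "continuous_on (sphere 0 r) (\<lambda>z. z * deriv f z)" if "f holomorphic_on unit_disc" for f
        using that r by (intro continuous_on_circle holomorphic_intros) auto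
      have "circle_mean r (\<lambda>z. (cmod (z * deriv a z))\<^sup>2 + (cmod (z * deriv b z))\<^sup>2) \<le> circle_mean r (\<lambda>z. B)"
      proof (rule circle_mean_mono)
        show "(cmod (z * deriv a z))\<^sup>2 + (cmod (z * deriv b z))\<^sup>2 \<le> B" if "cmod z = r" for z
        proof -
          have "(cmod (z * deriv a z))\<^sup>2 + (cmod (z * deriv b z))\<^sup>2
              = r\<^sup>2 * ((cmod (deriv a z))\<^sup>2 + (cmod (deriv b z))\<^sup>2)"
            by (simp add: norm_mult that power_mult_distrib distrib_left)
          also have "\<dots> \<le> 1 * B"
            using r that B B0 by (intro mult_mono) (auto simp: power_le_one)
          finally show ?thesis by simp
        qed
      qed (use r cont[OF hol_a] cont[OF hol_b] in \<open>auto intro!: continuous_on_add continuous_on_power continuous_on_norm\<close>)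
      then have "circle_mean r (\<lambda>z. (cmod (z * deriv a z))\<^sup>2 + (cmod (z * deriv b z))\<^sup>2) \<le> B + e"
        using e by simp
      then show ?case
        using energy_sums_gen[OF r taylor_sums_deriv[OF hol_a] cont[OF hol_a] taylor_sums_deriv[OF hol_b] cont[OF hol_b]]
        by blast
    qed
  qed (simp add: energy_nonneg)
  then show ?thesis
    by (intro summableI_nonneg_bounded[of _ B]) (simp_all add: energy_nonneg)
qed

text \<open>The sum is the mean of \<open>|z^2 a''|^2 + |z^2 b''|^2\<close> over \<open>|z| = r\<close>. Boundedness of \<open>a'\<close> and \<open>b'\<close> alone
  would only make the expression bounded; each summand tends to 0 and is dominated by
  \<open>n^2 energy n\<close>, so summability of the latter gives the limit 0.\<close>

lemma second_deriv_mean_tendsto: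
  assumes sm: "summable (\<lambda>n. (real n)\<^sup>2 * energy n)"
  shows "((\<lambda>r. (1 - r)\<^sup>2 * (\<Sum>n. (real (n * (n - 1)))\<^sup>2 * energy n * r ^ (2 * n))) \<longlongrightarrow> 0) (at_left 1)"
proof -
  let ?t = "\<lambda>n r. (1 - r)\<^sup>2 * ((real (n * (n - 1)))\<^sup>2 * energy n * r ^ (2 * n))"
  have ev: "eventually (\<lambda>r::real. r \<in> {0<..<1}) (at_left 1)"
    using eventually_at_left_real[of 0 1] by simp
  have bound: "norm (?t n r) \<le> (real n)\<^sup>2 * energy n" if "r \<in> {0<..<1}" for n r
  proof -
    have "(1 - r) * (real (n - 1) * r ^ n) \<le> (1 - r) * (real n * r ^ n)"
      using that by (intro mult_left_mono mult_right_mono) auto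
    also have "\<dots> \<le> 1" using that by (intro one_minus_mult_power_le) auto
    finally have "((1 - r) * (real (n - 1) * r ^ n))\<^sup>2 \<le> 1"
      using that by (intro power_le_one) auto
    then have "((1 - r) * (real (n - 1) * r ^ n))\<^sup>2 * ((real n)\<^sup>2 * energy n) \<le> 1 * ((real n)\<^sup>2 * energy n)"
      by (rule mult_right_mono) (simp add: energy_nonneg)
    moreover have "?t n r = ((1 - r) * (real (n - 1) * r ^ n))\<^sup>2 * ((real n)\<^sup>2 * energy n)"
      by (simp only: of_nat_mult power_mult_distrib power_mult power_even_eq mult_ac)
    moreover have "0 \<le> ?t n r" using that energy_nonneg by simp
    ultimately show ?thesis by (simp only: real_norm_def abs_of_nonneg mult_1)
  qed
  have "((\<lambda>r. \<Sum>n. ?t n r) \<longlongrightarrow> (\<Sum>n. 0)) (at_left 1)"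
  proof (rule tannerys_theorem[THEN conjunct2, THEN conjunct2, OF _ _ sm])
    show "(?t n \<longlongrightarrow> 0) (at_left 1)" for n
    proof -
      have "(?t n \<longlongrightarrow> (1 - 1)\<^sup>2 * ((real (n * (n - 1)))\<^sup>2 * energy n * 1 ^ (2 * n))) (at_left 1)"
        by (intro tendsto_intros)
      then show ?thesis by simp
    qed
    show "eventually (\<lambda>(n, r). norm (?t n r) \<le> (real n)\<^sup>2 * energy n) (sequentially \<times>\<^sub>F at_left 1)"
      unfolding eventually_prod_filter using ev bound
      by (intro exI[of _ "\<lambda>_. True"] exI[of _ "\<lambda>r. r \<in> {0<..<1}"]) auto
  qed simp
  moreover have "eventually (\<lambda>r. (\<Sum>n. ?t n r) = (1 - r)\<^sup>2 * (\<Sum>n. (real (n * (n - 1)))\<^sup>2 * energy n * r ^ (2 * n))) (at_left 1)"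
    using ev
  proof eventually_elim
    case (elim r)
    then have r: "0 \<le> r" "r < 1" by auto
    have cont: "continuous_on (sphere 0 r) (\<lambda>z. z\<^sup>2 * deriv (deriv f) z)" if "f holomorphic_on unit_disc" for f
      using that r by (intro continuous_on_circle holomorphic_intros) auto
    show ?case
      by (rule suminf_mult[OF sums_summable[OF energy_sums_gen[OF r taylor_sums_deriv2[OF hol_a] cont[OF hol_a] taylor_sums_deriv2[OF hol_b] cont[OF hol_b]]]])
  qed
  ultimately show ?thesis by (simp add: tendsto_cong)
qed

text \<open>The Wronskian is constant, so \<open>(a'', b'')\<close> has determinant 0 against \<open>(a, b)\<close> and is a multiple of it.
  Here \<open>- 2 l\<close> is the Schwarzian derivative of \<open>b / a\<close>.\<close>

lemma deriv2_proportional: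
  assumes z: "z \<in> unit_disc"
  defines "l \<equiv> deriv b z * deriv (deriv a) z - deriv a z * deriv (deriv b) z"
  shows "deriv (deriv a) z = l * a z" "deriv (deriv b) z = l * b z"
proof -
  have d: "(f has_field_derivative deriv f z) (at z)" if "f holomorphic_on unit_disc" for f
    using that z by (auto intro: holomorphic_derivI)
  have "((\<lambda>z. a z * deriv b z - b z * deriv a z) has_field_derivative
      a z * deriv (deriv b) z - b z * deriv (deriv a) z) (at z)"
    by (auto intro!: derivative_eq_intros d[OF hol_deriv[OF hol_a]] d[OF hol_deriv[OF hol_b]] d[OF hol_a] d[OF hol_b])
  moreover have "((\<lambda>z. a z * deriv b z - b z * deriv a z) has_field_derivative 0) (at z)"
    by (rule has_field_derivative_transform_within_open[of "\<lambda>_. 1" _ _ unit_disc])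
       (use z wronskian in auto)
  ultimately have 0: "a z * deriv (deriv b) z = b z * deriv (deriv a) z"
    using DERIV_unique by fastforce
  note w = wronskian[OF z]
  show "deriv (deriv a) z = l * a z" unfolding l_def using 0 w by algebra
  show "deriv (deriv b) z = l * b z" unfolding l_def using 0 w by algebra
qed

text \<open>Parseval turns the mean of \<open>\<langle>z^2 Y'', Y\<rangle>\<close> into a sum of nonnegative terms, while the boundary
  condition makes the same mean small: \<open>z^2 Y'' = L Y\<close> with \<open>L 0 = 0\<close>, so replacing \<open>|Y|^2\<close> by its
  boundary value \<open>R\<close> would give mean 0.\<close>

theorem energy_eq_0:
  assumes lim: "(\<rho> \<longlongrightarrow> R) to_circle" and R: "0 < R" and n: "2 \<le> n"
  shows "energy n = 0"
proof -
  obtain K where K: "0 < K" "\<And>z. z \<in> unit_disc \<Longrightarrow> \<rho> z \<le> R" "\<And>z. z \<in> unit_disc \<Longrightarrow> R - \<rho> z \<le> K * (1 - cmod z)"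
    using \<rho>_near_boundary_value[OF lim R] by blast
  obtain m where m: "0 < m" "\<And>z. z \<in> unit_disc \<Longrightarrow> m \<le> \<rho> z"
    using \<rho>_bounded_below[OF lim R] by blast
  define L where "L z = z\<^sup>2 * (deriv b z * deriv (deriv a) z - deriv a z * deriv (deriv b) z)" for z
  have holL: "L holomorphic_on unit_disc"
    unfolding L_def using hol_a hol_b by (intro holomorphic_intros) auto
  have La: "z\<^sup>2 * deriv (deriv a) z = L z * a z" and Lb: "z\<^sup>2 * deriv (deriv b) z = L z * b z" if "cmod z < 1" for z
    using deriv2_proportional[of z] that by (simp_all add: L_def)
  let ?N = "\<lambda>r. \<Sum>n. (real (n * (n - 1)))\<^sup>2 * energy n * r ^ (2 * n)"
  let ?e = "\<lambda>e r. e * K\<^sup>2 + (1 - r)\<^sup>2 * ?N r / (m * e)"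
  have main: "real (n * (n - 1)) * energy n * r ^ (2 * n) \<le> ?e e r" if r': "r \<in> {0<..<1}" and e: "0 < e" for r e
  proof -
    from r' have r: "0 \<le> r" "r < 1" by auto
    have cont: "continuous_on (sphere 0 r) f" if "f holomorphic_on unit_disc" for f
      by (rule continuous_on_circle[OF that r(2)])
    have cont2: "continuous_on (sphere 0 r) (\<lambda>z. z\<^sup>2 * deriv (deriv f) z)" if "f holomorphic_on unit_disc" for f
      using that by (intro cont holomorphic_intros) auto
    have cont\<rho>: "continuous_on (sphere 0 r) \<rho>"
      using r by (intro continuous_on_subset[OF continuous_\<rho>]) auto
    have in_disc: "z \<in> unit_disc" if "cmod z = r" for z using that r by simp
    let ?M = "circle_mean r (\<lambda>z. L z * of_real (\<rho> z - R))"
    have S: "(\<lambda>k. of_nat (k * (k - 1)) * taylor f k * cnj (taylor f k) * of_real (r ^ (2 * k)))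
        sums circle_mean r (\<lambda>z. z\<^sup>2 * deriv (deriv f) z * cnj (f z))" if "f holomorphic_on unit_disc" for f
      by (rule parseval[OF r taylor_sums_deriv2[OF that] taylor_sums[OF that] cont2[OF that] cont[OF that]])
    have "circle_mean r (\<lambda>z. z\<^sup>2 * deriv (deriv a) z * cnj (a z)) + circle_mean r (\<lambda>z. z\<^sup>2 * deriv (deriv b) z * cnj (b z))
        = circle_mean r (\<lambda>z. z\<^sup>2 * deriv (deriv a) z * cnj (a z) + z\<^sup>2 * deriv (deriv b) z * cnj (b z))"
      using r by (intro circle_mean_add[symmetric] continuous_on_mult continuous_on_cnj cont2 cont hol_a hol_b)
    also have "\<dots> = circle_mean r (\<lambda>z. L z * of_real (\<rho> z))"
    proof (rule circle_mean_cong[OF r(1)])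
      fix z assume "cmod z = r"
      then have "cmod z < 1" using r by simp
      then show "z\<^sup>2 * deriv (deriv a) z * cnj (a z) + z\<^sup>2 * deriv (deriv b) z * cnj (b z) = L z * of_real (\<rho> z)"
        by (simp only: La Lb \<rho>_def of_real_add complex_norm_square distrib_left mult.assoc)
    qed
    (* The subtracted mean is \<open>L 0 = 0\<close>. *)
    also have "\<dots> = circle_mean r (\<lambda>z. L z * of_real (\<rho> z)) - of_real R * circle_mean r L"
      using circle_mean_holomorphic[OF r holL] by (simp add: L_def)
    also have "\<dots> = circle_mean r (\<lambda>z. L z * of_real (\<rho> z)) - circle_mean r (\<lambda>z. of_real R * L z)"
      by (simp add: circle_mean_mult_left[OF r(1) cont[OF holL]])
    also have "\<dots> = circle_mean r (\<lambda>z. L z * of_real (\<rho> z) - of_real R * L z)"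
      using r by (intro circle_mean_diff[symmetric] continuous_on_mult continuous_on_of_real cont\<rho> cont holL continuous_on_const)
    also have "\<dots> = ?M" by (simp add: algebra_simps)
    finally have "(\<lambda>k. of_nat (k * (k - 1)) * taylor a k * cnj (taylor a k) * of_real (r ^ (2 * k))
        + of_nat (k * (k - 1)) * taylor b k * cnj (taylor b k) * of_real (r ^ (2 * k))) sums ?M"
      using sums_add[OF S[OF hol_a] S[OF hol_b]] by simp
    also have "(\<lambda>k. of_nat (k * (k - 1)) * taylor a k * cnj (taylor a k) * of_real (r ^ (2 * k))
        + of_nat (k * (k - 1)) * taylor b k * cnj (taylor b k) * of_real (r ^ (2 * k)))
        = (\<lambda>k. complex_of_real (real (k * (k - 1)) * energy k * r ^ (2 * k)))"
      by (simp add: energy_def complex_norm_square algebra_simps del: of_real_power of_nat_mult)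
    finally have "(\<lambda>k. real (k * (k - 1)) * energy k * r ^ (2 * k)) sums Re ?M"
      using sums_Re by fastforce
    then have "real (n * (n - 1)) * energy n * r ^ (2 * n) \<le> Re ?M"
      using r energy_nonneg sum_le_suminf[of "\<lambda>k. real (k * (k - 1)) * energy k * r ^ (2 * k)" "{n}"]
      by (simp add: sums_iff)
    also have "\<dots> \<le> cmod ?M" by (rule complex_Re_le_cmod)
    also have "\<dots> \<le> circle_mean r (\<lambda>z. e * K\<^sup>2 + (1 - r)\<^sup>2 / e * (cmod (L z))\<^sup>2)"
    proof (rule norm_circle_mean_le)
      show "cmod (L z * of_real (\<rho> z - R)) \<le> e * K\<^sup>2 + (1 - r)\<^sup>2 / e * (cmod (L z))\<^sup>2" if "cmod z = r" for z
      proof -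
        have "\<bar>\<rho> z - R\<bar> \<le> K * (1 - r)"
          using K(2,3)[OF in_disc[OF that]] that by simp
        then have "cmod (L z * of_real (\<rho> z - R)) \<le> cmod (L z) * (K * (1 - r))"
          unfolding norm_mult norm_of_real by (rule mult_left_mono) simp
        also have "\<dots> \<le> e * K\<^sup>2 + (1 - r)\<^sup>2 / e * (cmod (L z))\<^sup>2"
        proof -
          define x where "x = (1 - r) * cmod (L z)"
          (* The product of \<open>K\<close> and \<open>x\<close> is split so that the large factor \<open>|L|\<close> is squared, which Parseval controls. *)
          have "0 \<le> (e * K - x)\<^sup>2 + (e * K)\<^sup>2 + x\<^sup>2" by simp
          then have "(K * x) * e \<le> (e * K)\<^sup>2 + x\<^sup>2"
            by (simp add: power2_eq_square algebra_simps)
          then have "K * x \<le> ((e * K)\<^sup>2 + x\<^sup>2) / e" using e by (simp only: pos_le_divide_eq)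
          also have "\<dots> = e * K\<^sup>2 + x\<^sup>2 / e"
            using e by (simp add: add_divide_distrib power2_eq_square)
          finally show ?thesis by (simp add: x_def power_mult_distrib mult_ac)
        qed
        finally show ?thesis .
      qed
    qed (use r e cont[OF holL] cont\<rho> in \<open>auto intro!: continuous_intros\<close>)
    also have "\<dots> = e * K\<^sup>2 + (1 - r)\<^sup>2 / e * circle_mean r (\<lambda>z. (cmod (L z))\<^sup>2)"
    proof -
      have "continuous_on (sphere 0 r) (\<lambda>z. (cmod (L z))\<^sup>2)"
        by (intro continuous_on_power continuous_on_norm cont holL)
      from circle_mean_mult_left[OF r(1) this, of "(1 - r)\<^sup>2 / e"]
        circle_mean_add[OF r(1) continuous_on_const continuous_on_mult[OF continuous_on_const this], of "e * K\<^sup>2" "(1 - r)\<^sup>2 / e"]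
      show ?thesis by simp
    qed
    also have "\<dots> \<le> ?e e r"
    proof -
      have "m * circle_mean r (\<lambda>z. (cmod (L z))\<^sup>2) = circle_mean r (\<lambda>z. m * (cmod (L z))\<^sup>2)"
        using r cont[OF holL] by (intro circle_mean_mult_left[symmetric] continuous_intros)
      also have "\<dots> \<le> circle_mean r (\<lambda>z. (cmod (z\<^sup>2 * deriv (deriv a) z))\<^sup>2 + (cmod (z\<^sup>2 * deriv (deriv b) z))\<^sup>2)"
      proof (rule circle_mean_mono)
        show "m * (cmod (L z))\<^sup>2 \<le> (cmod (z\<^sup>2 * deriv (deriv a) z))\<^sup>2 + (cmod (z\<^sup>2 * deriv (deriv b) z))\<^sup>2" if "cmod z = r" for z
        proof -
          have z: "cmod z < 1" using that r by simp
          have "m * (cmod (L z))\<^sup>2 \<le> \<rho> z * (cmod (L z))\<^sup>2"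
            by (intro mult_right_mono m in_disc that) simp
          also have "\<dots> = (cmod (z\<^sup>2 * deriv (deriv a) z))\<^sup>2 + (cmod (z\<^sup>2 * deriv (deriv b) z))\<^sup>2"
            unfolding La[OF z] Lb[OF z] \<rho>_def by (simp add: norm_mult power_mult_distrib algebra_simps)
          finally show ?thesis .
        qed
      qed (intro r continuous_on_add continuous_on_mult continuous_on_power continuous_on_norm continuous_on_const cont holL cont2 hol_a hol_b)+
      also have "\<dots> = ?N r"
        by (rule sums_unique[OF energy_sums_gen[OF r taylor_sums_deriv2[OF hol_a] cont2[OF hol_a] taylor_sums_deriv2[OF hol_b] cont2[OF hol_b]]])
      finally have "circle_mean r (\<lambda>z. (cmod (L z))\<^sup>2) \<le> ?N r / m"
        using m(1) by (simp add: pos_le_divide_eq mult.commute)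
      then have "(1 - r)\<^sup>2 / e * circle_mean r (\<lambda>z. (cmod (L z))\<^sup>2) \<le> (1 - r)\<^sup>2 / e * (?N r / m)"
        using e by (intro mult_left_mono) auto
      then show ?thesis by (simp add: mult.commute)
    qed
    finally show ?thesis .
  qed
  have ev: "eventually (\<lambda>r::real. r \<in> {0<..<1}) (at_left 1)"
    using eventually_at_left_real[of 0 1] by simp
  have le: "real (n * (n - 1)) * energy n \<le> e * K\<^sup>2" if e: "0 < e" for e
  proof -
    have lower: "((\<lambda>r. real (n * (n - 1)) * energy n * r ^ (2 * n)) \<longlongrightarrow> real (n * (n - 1)) * energy n * 1 ^ (2 * n)) (at_left 1)"
      by (intro tendsto_intros)
    have upper: "(?e e \<longlongrightarrow> e * K\<^sup>2 + 0 / (m * e)) (at_left 1)"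
      using m e by (intro tendsto_intros second_deriv_mean_tendsto summable_square_weighted_energy[OF lim R]) auto
    have "real (n * (n - 1)) * energy n * 1 ^ (2 * n) \<le> e * K\<^sup>2 + 0 / (m * e)"
      by (rule tendsto_le[OF trivial_limit_at_left_real upper lower eventually_mono[OF ev main[OF _ e]]])
    then show ?thesis by simp
  qed
  have "real (n * (n - 1)) * energy n \<le> 0"
  proof (rule field_le_epsilon)
    fix e :: real assume "0 < e"
    then show "real (n * (n - 1)) * energy n \<le> 0 + e"
      using le[of "e / K\<^sup>2"] K(1) by simp
  qed
  then show ?thesis using n energy_nonneg[of n] by (auto simp: mult_le_0_iff)
qed

lemma coeffs_eq_0:
  assumes "energy n = 0"
  shows "taylor a n = 0" "taylor b n = 0"
  using assms by (auto simp: energy_def add_nonneg_eq_0_iff)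

text \<open>Once \<open>a\<close> and \<open>b\<close> are affine, \<open>\<rho>\<close> can have a limit at the circle only if \<open>a(0)\<close> and \<open>a'(0)\<close> are
  orthogonal; these are complex numbers and \<open>a 0 \<noteq> 0\<close>, so \<open>a'(0) = 0\<close>. The normalisation \<open>b 0 = 0\<close>
  excludes the other unitary rotations of the solution.\<close>

lemma affine_of_boundary_limit:
  assumes lim: "(\<rho> \<longlongrightarrow> R) to_circle" and R: "0 < R" and b0: "b 0 = 0"
  shows "n \<ge> 1 \<Longrightarrow> taylor a n = 0" "energy 0 + energy 1 = R"
proof -
  have aff: "f z = f 0 + taylor f 1 * z"
    if "f holomorphic_on unit_disc" "cmod z < 1" "\<And>n. 2 \<le> n \<Longrightarrow> taylor f n = 0" for f z
  proof -
    have "(\<lambda>n. taylor f n * z ^ n) sums (\<Sum>n<2. taylor f n * z ^ n)"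
      using that(3) by (intro sums_finite) auto
    then have "f z = (\<Sum>n<2. taylor f n * z ^ n)"
      using taylor_sums[OF that(1,2)] sums_unique2 by blast
    then show ?thesis by (simp add: eval_nat_numeral taylor_def)
  qed
  have a: "a z = a 0 + taylor a 1 * z" and b: "b z = taylor b 1 * z" if "cmod z < 1" for z
    using aff[OF hol_a that] aff[OF hol_b that] coeffs_eq_0[OF energy_eq_0[OF lim R]] b0 by auto
  have a0: "a 0 \<noteq> 0" using wronskian[of 0] b0 by auto
  have ev: "eventually (\<lambda>r::real. r \<in> {0<..<1}) (at_left 1)"
    using eventually_at_left_real[of 0 1] by simp
  have a1: "taylor a 1 = 0"
  proof (rule ccontr)
    assume nz: "taylor a 1 \<noteq> 0"
    define p where "p = cnj (a 0) * taylor a 1"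
    (* In the direction \<open>u\<close> the values at \<open>r u\<close> and \<open>- r u\<close> differ most: by \<open>4 r |p|\<close>. *)
    define u where "u = cnj p / of_real (cmod p)"
    have p: "p \<noteq> 0" using nz a0 by (simp add: p_def)
    have u: "cmod u = 1" using p by (simp add: u_def norm_divide)
    have pu: "p * u = of_real (cmod p)"
    proof -
      have "p * u = of_real ((cmod p)\<^sup>2) / of_real (cmod p)"
        unfolding u_def complex_norm_square by simp
      then show ?thesis using p by (simp add: power2_eq_square)
    qed
    have "((\<lambda>r. \<rho> (of_real r * u) - \<rho> (of_real r * (- u))) \<longlongrightarrow> R - R) (at_left 1)"
      using u by (intro tendsto_diff filterlim_compose[OF lim filterlim_radius_to_circle]) auto
    moreover have "eventually (\<lambda>r. \<rho> (of_real r * u) - \<rho> (of_real r * (- u)) = 4 * r * cmod p) (at_left 1)"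
      using ev
    proof eventually_elim
      case (elim r)
      let ?z = "of_real r * u"
      have z: "cmod ?z < 1" "cmod (- ?z) < 1" using elim u by (auto simp: norm_mult)
      have "\<rho> ?z - \<rho> (- ?z) = 4 * Re (cnj (a 0) * (taylor a 1 * ?z))"
        unfolding \<rho>_def a[OF z(1)] a[OF z(2)] b[OF z(1)] b[OF z(2)] cmod_power2
        by (simp add: power2_eq_square algebra_simps)
      also have "cnj (a 0) * (taylor a 1 * ?z) = of_real r * (p * u)" by (simp add: p_def)
      also have "4 * Re \<dots> = 4 * r * cmod p" unfolding pu by simp
      finally show ?case by simp
    qed
    ultimately have "((\<lambda>r. 4 * r * cmod p) \<longlongrightarrow> R - R) (at_left 1)"
      by (simp add: tendsto_cong)
    moreover have "((\<lambda>r. 4 * r * cmod p) \<longlongrightarrow> 4 * 1 * cmod p) (at_left 1)"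
      by (intro tendsto_intros)
    ultimately have "R - R = 4 * 1 * cmod p"
      by (rule tendsto_unique[OF trivial_limit_at_left_real])
    then show False using p by simp
  qed
  show "taylor a n = 0" if "n \<ge> 1"
  proof (cases "n = 1")
    case False
    then show ?thesis using that by (intro coeffs_eq_0 energy_eq_0[OF lim R]) auto
  qed (use a1 in simp)
  have "((\<lambda>r. \<rho> (of_real r * 1)) \<longlongrightarrow> R) (at_left 1)"
    by (intro filterlim_compose[OF lim filterlim_radius_to_circle]) simp
  moreover have "eventually (\<lambda>r. \<rho> (of_real r * 1) = energy 0 + energy 1 * r\<^sup>2) (at_left 1)"
    using ev
  proof eventually_elim
    case (elim r)
    then show ?case
      using a[of r] b[of r] a1 b0 by (simp add: \<rho>_def energy_def norm_mult power_mult_distrib taylor_def)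
  qed
  ultimately have "((\<lambda>r. energy 0 + energy 1 * r\<^sup>2) \<longlongrightarrow> R) (at_left 1)"
    by (simp add: tendsto_cong)
  moreover have "((\<lambda>r. energy 0 + energy 1 * r\<^sup>2) \<longlongrightarrow> energy 0 + energy 1 * 1\<^sup>2) (at_left 1)"
    by (intro tendsto_intros)
  ultimately have "R = energy 0 + energy 1 * 1\<^sup>2"
    by (rule tendsto_unique[OF trivial_limit_at_left_real])
  then show "energy 0 + energy 1 = R" by simp
qed

end

section \<open>From a locally univalent function to a pair\<close>

text \<open>The function \<open>g\<close> is the quotient \<open>b / a\<close>, and \<open>a\<close> is a branch of \<open>1 / sqrt g'\<close>.\<close>

locale developing_pair = unit_wronskian_pair +
  fixes g :: "complex \<Rightarrow> complex" and t :: real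
  assumes g0: "g 0 = 0" and t_pos: "0 < t" and dg0: "deriv g 0 = of_real t"
    and hol_g: "g holomorphic_on unit_disc"
    and b_eq: "z \<in> unit_disc \<Longrightarrow> b z = g z * a z"
    and a_square: "z \<in> unit_disc \<Longrightarrow> deriv g z * (a z)\<^sup>2 = 1"
begin

lemma \<rho>_eq: "z \<in> unit_disc \<Longrightarrow> \<rho> z = (1 + (cmod (g z))\<^sup>2) / cmod (deriv g z)"
proof -
  assume z: "z \<in> unit_disc"
  have nz: "deriv g z \<noteq> 0" using a_square[OF z] by auto
  have "cmod (deriv g z) * (cmod (a z))\<^sup>2 = 1"
    using arg_cong[OF a_square[OF z], of cmod] by (simp add: norm_mult norm_power)
  then have "(cmod (a z))\<^sup>2 = 1 / cmod (deriv g z)" using nz by (simp add: field_simps)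
  then show ?thesis
    using nz by (simp add: \<rho>_def b_eq[OF z] norm_mult power_mult_distrib add_divide_distrib)
qed

lemma energy_0: "energy 0 = 1 / t"
  using \<rho>_eq[of 0] t_pos by (simp add: energy_def taylor_def \<rho>_def g0 dg0)

lemma energy_1: "energy 1 = (cmod (taylor a 1))\<^sup>2 + t"
proof -
  have d: "(f has_field_derivative deriv f 0) (at 0)" if "f holomorphic_on unit_disc" for f
    using that by (auto intro: holomorphic_derivI)
  have "((\<lambda>z. g z * a z) has_field_derivative of_real t * a 0) (at 0)"
    by (auto intro!: derivative_eq_intros d[OF hol_g] d[OF hol_a] simp: g0 dg0)
  then have "(b has_field_derivative of_real t * a 0) (at 0)"
    by (rule has_field_derivative_transform_within_open[of _ _ _ unit_disc]) (auto simp: b_eq)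
  then have "deriv b 0 = of_real t * a 0" by (rule DERIV_imp_deriv)
  then have "(cmod (taylor b 1))\<^sup>2 = t\<^sup>2 * (cmod (a 0))\<^sup>2"
    using t_pos by (simp add: taylor_def norm_mult power_mult_distrib)
  also have "(cmod (a 0))\<^sup>2 = 1 / t"
    using energy_0 by (simp add: energy_def taylor_def b_eq g0)
  finally show ?thesis using t_pos by (simp add: energy_def power2_eq_square)
qed

text \<open>If \<open>a\<close> is constant then so is \<open>g' = 1 / a^2\<close>.\<close>

lemma eq_linear:
  assumes "\<And>n. 1 \<le> n \<Longrightarrow> taylor a n = 0"
  shows "eq_on_disc g (\<lambda>z. of_real t * z)"
proof -
  have a: "a z = a 0" if "cmod z < 1" for z
  proof -
    have "(\<lambda>n. taylor a n * z ^ n) sums (\<Sum>n<1. taylor a n * z ^ n)"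
      using assms by (intro sums_finite) auto
    then show ?thesis using taylor_sums[OF hol_a that] sums_unique2 by (fastforce simp: taylor_def)
  qed
  have dg: "deriv g z = of_real t" if "z \<in> unit_disc" for z
  proof -
    have "deriv g z * (a 0)\<^sup>2 = deriv g 0 * (a 0)\<^sup>2" "(a 0)\<^sup>2 \<noteq> 0"
      using a_square[OF that] a_square[of 0] a[of z] that by auto
    then show ?thesis by (simp add: dg0)
  qed
  have "\<exists>k. \<forall>z\<in>unit_disc. g z - of_real t * z = k"
  proof (rule has_field_derivative_zero_constant)
    show "((\<lambda>z. g z - of_real t * z) has_field_derivative 0) (at z within unit_disc)" if "z \<in> unit_disc" for z
    proof -
      have "(g has_field_derivative of_real t) (at z)"
        using holomorphic_derivI[OF hol_g open_ball that] dg[OF that] by simp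
      then have "((\<lambda>z. g z - of_real t * z) has_field_derivative 0) (at z)"
        by (auto intro!: derivative_eq_intros)
      then show ?thesis by (rule has_field_derivative_at_within)
    qed
  qed simp
  then obtain k where k: "\<And>z. z \<in> unit_disc \<Longrightarrow> g z - of_real t * z = k" by blast
  with k[of 0] g0 show ?thesis by (auto simp: eq_on_disc_def)
qed

lemma solution_is_linear:
  assumes lim: "(\<rho> \<longlongrightarrow> R) to_circle" and R: "0 < R"
  shows "t + 1 / t = R" "eq_on_disc g (\<lambda>z. of_real t * z)"
proof -
  have b0: "b 0 = 0" by (simp add: b_eq g0)
  have a: "taylor a n = 0" if "n \<ge> 1" for n
    using that by (rule affine_of_boundary_limit(1)[OF lim R b0])
  then show "eq_on_disc g (\<lambda>z. of_real t * z)" by (intro eq_linear)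
  show "t + 1 / t = R"
    using affine_of_boundary_limit(2)[OF lim R b0] unfolding energy_0 energy_1 a[OF order_refl] by simp
qed

text \<open>The first two coefficients already contribute \<open>t + 1 / t\<close> to a sum bounded by \<open>R\<close>; in the case of
  equality nothing is left for \<open>a'(0)\<close> and the higher coefficients.\<close>

lemma subsolution_bound:
  assumes bd: "\<And>e. 0 < e \<Longrightarrow> eventually (\<lambda>z. \<rho> z < R + e) to_circle"
  shows "t + 1 / t \<le> R" "t + 1 / t = R \<Longrightarrow> eq_on_disc g (\<lambda>z. of_real t * z)"
proof -
  have sum: "(\<Sum>n<N. energy n) \<le> R" for N by (rule energy_partial_sum_le[OF bd])
  have 2: "(\<Sum>n<2. energy n) = t + 1 / t + (cmod (taylor a 1))\<^sup>2"
    by (simp add: eval_nat_numeral energy_0 energy_1[simplified])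
  then show "t + 1 / t \<le> R"
    using sum[of 2] zero_le_power2[of "cmod (taylor a 1)"] by linarith
  assume eq: "t + 1 / t = R"
  have "taylor a n = 0" if "1 \<le> n" for n
  proof (cases "n = 1")
    case True
    have "(cmod (taylor a 1))\<^sup>2 \<le> 0" using sum[of 2] 2 eq by linarith
    then show ?thesis using True by simp
  next
    case False
    then have "(\<Sum>k<2. energy k) + energy n = (\<Sum>k\<in>insert n {..<2}. energy k)"
      using that by simp
    also have "\<dots> \<le> (\<Sum>k<Suc n. energy k)"
      using that by (intro sum_mono2) (auto simp: energy_nonneg)
    also have "\<dots> \<le> R" by (rule sum)
    finally have "energy n \<le> 0"
      using 2 eq zero_le_power2[of "cmod (taylor a 1)"] by linarith
    then have "energy n = 0" using energy_nonneg[of n] by simp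
    then show ?thesis by (rule coeffs_eq_0)
  qed
  then show "eq_on_disc g (\<lambda>z. of_real t * z)" by (rule eq_linear)
qed

end

lemma locally_univalent_deriv_nonzero:
  assumes "g holomorphic_on unit_disc" "locally_univalent g" "z \<in> unit_disc"
  shows "deriv g z \<noteq> 0"
  using assms unfolding locally_univalent_def
  by (meson holomorphic_injective_imp_regular holomorphic_on_subset)

lemma univalent_imp_locally_univalent: "univalent g \<Longrightarrow> locally_univalent g"
  unfolding univalent_def locally_univalent_def by (auto intro!: exI[of _ unit_disc])

lemma exists_developing_pair:
  assumes g: "g \<in> H0" and lu: "locally_univalent g"
  obtains a b where "developing_pair a b g (Re (deriv g 0))"
proof -
  have hol: "g holomorphic_on unit_disc" and g0: "g 0 = 0" and dg0: "deriv g 0 \<in> \<real>" "0 < Re (deriv g 0)"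
    using g by (auto simp: H0_def)
  have nz: "\<And>z. z \<in> unit_disc \<Longrightarrow> deriv g z \<noteq> 0"
    using locally_univalent_deriv_nonzero[OF hol lu] .
  have "contractible unit_disc" by (simp add: convex_imp_contractible)
  moreover have "deriv g holomorphic_on unit_disc" using hol by (rule holomorphic_deriv) simp
  ultimately obtain h where h: "h holomorphic_on unit_disc" "\<And>z. z \<in> unit_disc \<Longrightarrow> deriv g z = (h z)\<^sup>2"
    using contractible_imp_holomorphic_sqrt[of "deriv g" unit_disc] nz by blast
  have hnz: "h z \<noteq> 0" if "z \<in> unit_disc" for z using nz[OF that] h(2)[OF that] by auto
  define a where "a z = 1 / h z" for z
  define b where "b z = g z * a z" for z
  have hol_a: "a holomorphic_on unit_disc"
    unfolding a_def using hnz h(1) by (intro holomorphic_intros) auto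
  have sq: "deriv g z * (a z)\<^sup>2 = 1" if "z \<in> unit_disc" for z
    using h(2)[OF that] hnz[OF that] by (simp add: a_def power_divide)
  have wr: "a z * deriv b z - b z * deriv a z = 1" if z: "z \<in> unit_disc" for z
  proof -
    have "(b has_field_derivative deriv g z * a z + deriv a z * g z) (at z)"
      unfolding b_def by (intro DERIV_mult holomorphic_derivI[OF hol _ z] holomorphic_derivI[OF hol_a _ z]) auto
    then have "deriv b z = deriv g z * a z + deriv a z * g z" by (rule DERIV_imp_deriv)
    then show ?thesis using sq[OF z] by (simp add: b_def power2_eq_square algebra_simps)
  qed
  have "developing_pair a b g (Re (deriv g 0))"
  proof unfold_locales
    show "b holomorphic_on unit_disc" unfolding b_def by (intro holomorphic_intros hol hol_a)
  qed (use hol hol_a g0 dg0 sq wr in \<open>auto simp: b_def of_real_Re\<close>)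
  then show thesis by (rule that)
qed

lemma eq_on_disc_deriv:
  assumes "eq_on_disc f g" "z \<in> unit_disc"
  shows "deriv f z = deriv g z"
  by (rule deriv_cong_ev)
     (use assms eventually_nhds_in_open[of unit_disc z] in \<open>auto simp: eq_on_disc_def elim!: eventually_mono\<close>)

section \<open>Linear functions and the two problems\<close>

context
  fixes c t :: real and g :: "complex \<Rightarrow> complex"
  assumes c: "0 < c" and t: "0 < t" and root: "t + 1 / t = 1 / c"
    and g: "eq_on_disc g (\<lambda>z. of_real t * z)"
begin

lemma linear_deriv: "z \<in> unit_disc \<Longrightarrow> deriv g z = of_real t"
  using eq_on_disc_deriv[OF g] by simp

lemma linear_in_H0: "g \<in> H0"
proof -
  have "g holomorphic_on unit_disc"
    by (rule holomorphic_transform[of "\<lambda>z. of_real t * z"])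
       (use g in \<open>auto simp: eq_on_disc_def intro!: holomorphic_intros\<close>)
  then show ?thesis using linear_deriv[of 0] t g by (simp add: H0_def eq_on_disc_def)
qed

lemma linear_univalent: "univalent g"
  using g t by (auto simp: univalent_def inj_on_def eq_on_disc_def)

lemma linear_solves: "solves_bvp c g"
proof -
  have root': "t = c * (1 + t\<^sup>2)" using root c t by (simp add: field_simps power2_eq_square)
  have "((\<lambda>z. c * t\<^sup>2 * (1 - (cmod z)\<^sup>2)) \<longlongrightarrow> c * t\<^sup>2 * (1 - 1\<^sup>2)) to_circle"
    by (intro tendsto_intros norm_tendsto_to_circle)
  then have "((\<lambda>z. c * t\<^sup>2 * (1 - (cmod z)\<^sup>2)) \<longlongrightarrow> 0) to_circle" by simp
  moreover have "eventually (\<lambda>z. c * t\<^sup>2 * (1 - (cmod z)\<^sup>2) = cmod (deriv g z) - c * (1 + (cmod (g z))\<^sup>2)) to_circle"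
    unfolding eventually_to_circle
  proof (intro exI[of _ 0] conjI allI impI)
    fix z assume "0 < cmod z \<and> cmod z < 1"
    then have "deriv g z = of_real t" "g z = of_real t * z"
      using linear_deriv g by (auto simp: eq_on_disc_def)
    then show "c * t\<^sup>2 * (1 - (cmod z)\<^sup>2) = cmod (deriv g z) - c * (1 + (cmod (g z))\<^sup>2)"
      using t root' by (simp add: norm_mult power_mult_distrib algebra_simps)
  qed simp
  ultimately show ?thesis unfolding solves_bvp_def by (rule Lim_transform_eventually)
qed

lemma linear_in_B: "g \<in> B (Phi c)"
proof -
  have "((\<lambda>z. ereal (cmod (deriv g z) - Phi c (g z))) \<longlongrightarrow> ereal 0) to_circle"
    using linear_solves by (intro tendsto_ereal) (simp add: solves_bvp_def Phi_def)
  then have "Liminf to_circle (\<lambda>z. ereal (cmod (deriv g z) - Phi c (g z))) = ereal 0"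
    by (rule lim_imp_Liminf[OF to_circle_neq_bot])
  then show ?thesis using linear_in_H0 linear_univalent by (simp add: B_def zero_ereal_def)
qed

end

text \<open>Dividing the boundary condition by \<open>1 + |g|^2 \<ge> 1\<close> gives \<open>1 / \<rho> \<rightarrow> c\<close>, even if \<open>g\<close> is
  unbounded.\<close>

lemma solution_iff:
  assumes c: "0 < c"
  shows "g \<in> H0 \<and> locally_univalent g \<and> solves_bvp c g \<longleftrightarrow>
    (\<exists>t>0. t + 1 / t = 1 / c \<and> eq_on_disc g (\<lambda>z. of_real t * z))"
proof
  assume "\<exists>t>0. t + 1 / t = 1 / c \<and> eq_on_disc g (\<lambda>z. of_real t * z)"
  then show "g \<in> H0 \<and> locally_univalent g \<and> solves_bvp c g"
    using linear_in_H0[OF c] linear_univalent[OF c] linear_solves[OF c] univalent_imp_locally_univalent by blast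
next
  assume asm: "g \<in> H0 \<and> locally_univalent g \<and> solves_bvp c g"
  then obtain a b where "developing_pair a b g (Re (deriv g 0))"
    using exists_developing_pair by blast
  then interpret developing_pair a b g "Re (deriv g 0)" .
  have "((\<lambda>z. 1 / \<rho> z - c) \<longlongrightarrow> 0) to_circle"
  proof (rule Lim_null_comparison)
    show "((\<lambda>z. \<bar>cmod (deriv g z) - c * (1 + (cmod (g z))\<^sup>2)\<bar>) \<longlongrightarrow> 0) to_circle"
      using asm by (simp add: solves_bvp_def tendsto_rabs_zero)
    show "eventually (\<lambda>z. norm (1 / \<rho> z - c) \<le> \<bar>cmod (deriv g z) - c * (1 + (cmod (g z))\<^sup>2)\<bar>) to_circle"
      unfolding eventually_to_circle
    proof (intro exI[of _ 0] conjI allI impI)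
      fix z assume "0 < cmod z \<and> cmod z < 1"
      then have "\<rho> z = (1 + (cmod (g z))\<^sup>2) / cmod (deriv g z)" by (intro \<rho>_eq) simp
      moreover have q: "1 \<le> 1 + (cmod (g z))\<^sup>2" by simp
      moreover from q have "1 + (cmod (g z))\<^sup>2 \<noteq> 0" by linarith
      ultimately have "1 / \<rho> z - c = (cmod (deriv g z) - c * (1 + (cmod (g z))\<^sup>2)) / (1 + (cmod (g z))\<^sup>2)"
        by (simp add: diff_divide_distrib)
      also have "norm \<dots> \<le> \<bar>cmod (deriv g z) - c * (1 + (cmod (g z))\<^sup>2)\<bar> / 1"
        unfolding real_norm_def abs_divide using q by (intro divide_left_mono) (auto simp: add_pos_nonneg)
      finally show "norm (1 / \<rho> z - c) \<le> \<bar>cmod (deriv g z) - c * (1 + (cmod (g z))\<^sup>2)\<bar>" by simp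
    qed simp
  qed
  then have "((\<lambda>z. 1 / \<rho> z) \<longlongrightarrow> c) to_circle" by (simp add: LIM_zero_iff)
  then have "((\<lambda>z. 1 / (1 / \<rho> z)) \<longlongrightarrow> 1 / c) to_circle"
    using c by (intro tendsto_divide tendsto_const) auto
  then have "(\<rho> \<longlongrightarrow> 1 / c) to_circle" by simp
  from solution_is_linear[OF this] c t_pos
  show "\<exists>t>0. t + 1 / t = 1 / c \<and> eq_on_disc g (\<lambda>z. of_real t * z)" by auto
qed

lemma B_bound:
  assumes c: "0 < c" and g: "g \<in> B (Phi c)"
  defines "t \<equiv> Re (deriv g 0)"
  shows "0 < t" "t + 1 / t \<le> 1 / c" "t + 1 / t = 1 / c \<Longrightarrow> eq_on_disc g (\<lambda>z. of_real t * z)"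
proof -
  have "g \<in> H0" "locally_univalent g" and li: "0 \<le> Liminf to_circle (\<lambda>z. ereal (cmod (deriv g z) - Phi c (g z)))"
    using g univalent_imp_locally_univalent by (auto simp: B_def)
  then obtain a b where "developing_pair a b g t"
    unfolding t_def using exists_developing_pair by blast
  then interpret developing_pair a b g t .
  show "0 < t" by (rule t_pos)
  have bd: "eventually (\<lambda>z. \<rho> z < 1 / c + e) to_circle" if e: "0 < e" for e
  proof -
    (* Chosen so that \<open>|g'| / (1 + |g|^2) > c - d\<close> means \<open>\<rho> < 1 / c + e\<close>. *)
    define d where "d = c - 1 / (1 / c + e)"
    have "1 / (1 / c + e) < 1 / (1 / c)" using c e by (intro divide_strict_left_mono) (auto intro!: divide_pos_pos add_pos_pos)
    then have d: "0 < d" by (simp add: d_def)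
    have "ereal (- d) < Liminf to_circle (\<lambda>z. ereal (cmod (deriv g z) - Phi c (g z)))"
      using li d by (intro less_le_trans[OF _ li]) simp
    then have "eventually (\<lambda>z. ereal (- d) < ereal (cmod (deriv g z) - Phi c (g z))) to_circle"
      by (rule less_LiminfD)
    moreover have "eventually (\<lambda>z. cmod z < 1) to_circle"
      unfolding eventually_to_circle by (intro exI[of _ 0]) simp
    ultimately show ?thesis
    proof eventually_elim
      case (elim z)
      let ?q = "1 + (cmod (g z))\<^sup>2"
      have q: "1 \<le> ?q" by simp
      have "d * 1 \<le> d * ?q" using d by (intro mult_left_mono q) simp
      then have "(c - d) * ?q < cmod (deriv g z)"
        using elim(1) by (simp add: Phi_def algebra_simps)
      moreover have "c - d = 1 / (1 / c + e)" by (simp add: d_def)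
      moreover have pos: "0 < 1 / c + e" using c e by (intro add_pos_pos) auto
      ultimately have lt: "?q < cmod (deriv g z) * (1 / c + e)" by (simp add: field_simps)
      then have "0 < cmod (deriv g z)"
        using q pos by (smt (verit) norm_ge_zero mult_eq_0_iff)
      then show ?case
        using lt \<rho>_eq[of z] elim(2) by (simp add: pos_divide_less_eq mult.commute)
    qed
  qed
  show "t + 1 / t \<le> 1 / c" "t + 1 / t = 1 / c \<Longrightarrow> eq_on_disc g (\<lambda>z. of_real t * z)"
    using subsolution_bound[OF bd] by auto
qed

context
  fixes c :: real
  assumes c: "0 < c" "c < 1/2"
begin

abbreviation (input) "root_plus \<equiv> (1 + sqrt (1 - 4 * c\<^sup>2)) / (2 * c)"
abbreviation (input) "root_minus \<equiv> (1 - sqrt (1 - 4 * c\<^sup>2)) / (2 * c)"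

lemma discriminant: "0 < sqrt (1 - 4 * c\<^sup>2)" "sqrt (1 - 4 * c\<^sup>2) < 1" "(sqrt (1 - 4 * c\<^sup>2))\<^sup>2 = 1 - 4 * c\<^sup>2"
proof -
  have "c\<^sup>2 < (1/2)\<^sup>2" using c by (intro power_strict_mono) auto
  then have *: "0 < 1 - 4 * c\<^sup>2" by (simp add: power2_eq_square)
  then show "0 < sqrt (1 - 4 * c\<^sup>2)" "(sqrt (1 - 4 * c\<^sup>2))\<^sup>2 = 1 - 4 * c\<^sup>2" by simp_all
  show "sqrt (1 - 4 * c\<^sup>2) < 1" using c by simp
qed

lemma roots_pos: "0 < root_minus" "root_minus < root_plus"
  using discriminant c by (auto simp: divide_strict_right_mono)

text \<open>Multiplication by \<open>4 c^2 t\<close> and completion of the square relate \<open>t + 1 / t - 1 / c\<close> to the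
  discriminant of \<open>c t^2 - t + c\<close>.\<close>

lemma complete_square:
  assumes "0 < t"
  shows "t + 1 / t \<le> 1 / c \<longleftrightarrow> (2 * c * t - 1)\<^sup>2 \<le> (sqrt (1 - 4 * c\<^sup>2))\<^sup>2"
    and "t + 1 / t = 1 / c \<longleftrightarrow> (2 * c * t - 1)\<^sup>2 = (sqrt (1 - 4 * c\<^sup>2))\<^sup>2"
proof -
  have *: "(2 * c * t - 1)\<^sup>2 - (sqrt (1 - 4 * c\<^sup>2))\<^sup>2 = 4 * c\<^sup>2 * t * (t + 1 / t - 1 / c)"
    unfolding discriminant(3) using assms c by (simp add: field_simps power2_eq_square)
  have p: "0 < 4 * c\<^sup>2 * t" using assms c by simp
  show "t + 1 / t \<le> 1 / c \<longleftrightarrow> (2 * c * t - 1)\<^sup>2 \<le> (sqrt (1 - 4 * c\<^sup>2))\<^sup>2"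
    using * p mult_le_0_iff[of "4 * c\<^sup>2 * t" "t + 1 / t - 1 / c"] by (smt (verit))
  show "t + 1 / t = 1 / c \<longleftrightarrow> (2 * c * t - 1)\<^sup>2 = (sqrt (1 - 4 * c\<^sup>2))\<^sup>2"
    using * p mult_eq_0_iff[of "4 * c\<^sup>2 * t" "t + 1 / t - 1 / c"] by (smt (verit))
qed

lemma roots_iff: "0 < t \<Longrightarrow> t + 1 / t = 1 / c \<longleftrightarrow> t = root_plus \<or> t = root_minus"
  using c by (simp add: complete_square(2) power2_eq_iff) (auto simp: field_simps)

lemma between_roots:
  assumes "0 < t" "t + 1 / t \<le> 1 / c"
  shows "root_minus \<le> t" "t \<le> root_plus"
proof -
  have "\<bar>2 * c * t - 1\<bar> \<le> sqrt (1 - 4 * c\<^sup>2)"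
    using assms complete_square(1) discriminant(1) by (simp add: abs_le_square_iff[symmetric] del: real_sqrt_pow2_iff real_sqrt_pow2)
  then show "root_minus \<le> t" "t \<le> root_plus" using c by (auto simp: field_simps abs_le_iff)
qed

end

theorem theorem3p4:
  fixes c :: real
  assumes "c > 0"
  shows
    "(c < 1/2 \<longrightarrow>
        \<not> eq_on_disc (g_plus c) (g_minus c) \<and>
        (\<forall>g. g \<in> H0 \<and> locally_univalent g \<and> solves_bvp c g \<longleftrightarrow>
              eq_on_disc g (g_plus c) \<or> eq_on_disc g (g_minus c)) \<and>
        univalent (g_plus c) \<and> univalent (g_minus c) \<and>
        (\<forall>g. is_arg_max (\<lambda>h. Re (deriv h 0)) (\<lambda>h. h \<in> B (Phi c)) g \<longleftrightarrow>
              eq_on_disc g (g_plus c)) \<and>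
        (\<forall>g. is_arg_min (\<lambda>h. Re (deriv h 0)) (\<lambda>h. h \<in> B (Phi c)) g \<longleftrightarrow>
              eq_on_disc g (g_minus c)))
     \<and> (c = 1/2 \<longrightarrow>
        (\<forall>g. g \<in> H0 \<and> locally_univalent g \<and> solves_bvp c g \<longleftrightarrow>
              eq_on_disc g (\<lambda>z. z)))
     \<and> (c > 1/2 \<longrightarrow>
        \<not> (\<exists>g. g \<in> H0 \<and> locally_univalent g \<and> solves_bvp c g))"
proof (intro conjI impI)
  note sol = solution_iff[OF assms]
  have am_gm: "t + 1 / t - 2 = (t - 1)\<^sup>2 / t" if "0 < t" for t :: real
    using that by (simp add: field_simps power2_eq_square)
  {
    assume half: "c = 1/2"
    have two: "1 / c = 2" unfolding half by simp
    then have "t + 1 / t = 1 / c \<longleftrightarrow> (t - 1)\<^sup>2 / t = 0" if "0 < t" for t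
      using am_gm[OF that] by linarith
    then have "t + 1 / t = 1 / c \<longleftrightarrow> t = 1" if "0 < t" for t
      using that by simp
    then have "(\<exists>t>0. t + 1 / t = 1 / c \<and> eq_on_disc g (\<lambda>z. of_real t * z)) \<longleftrightarrow> eq_on_disc g (\<lambda>z. z)" for g
      using two by (auto intro!: exI[of _ 1])
    then show "\<forall>g. g \<in> H0 \<and> locally_univalent g \<and> solves_bvp c g \<longleftrightarrow> eq_on_disc g (\<lambda>z. z)"
      using sol by simp
  next
    assume "c > 1/2"
    then have "1 / c < 2" by (simp add: field_simps)
    moreover have "2 \<le> t + 1 / t" if "0 < t" for t :: real
    proof -
      have "0 \<le> (t - 1)\<^sup>2 / t" using that by simp
      then show ?thesis using am_gm[OF that] by linarith
    qed
    ultimately show "\<not> (\<exists>g. g \<in> H0 \<and> locally_univalent g \<and> solves_bvp c g)"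
      unfolding sol by fastforce
  }
  assume c: "c < 1/2"
  let ?p = "(1 + sqrt (1 - 4 * c\<^sup>2)) / (2 * c)" and ?m = "(1 - sqrt (1 - 4 * c\<^sup>2)) / (2 * c)"
  note cc = assms c
  have pos: "0 < ?m" "?m < ?p" "0 < ?p" using roots_pos[OF cc] by linarith+
  have root: "?p + 1 / ?p = 1 / c" "?m + 1 / ?m = 1 / c"
    using roots_iff[OF cc] pos by blast+
  have gp: "g_plus c = (\<lambda>z. of_real ?p * z)" and gm: "g_minus c = (\<lambda>z. of_real ?m * z)"
    by (simp_all add: g_plus_def g_minus_def fun_eq_iff)
  have refl: "eq_on_disc f f" for f by (simp add: eq_on_disc_def)
  have inB: "g \<in> B (Phi c)" "Re (deriv g 0) = t"
    if "0 < t" "t + 1 / t = 1 / c" "eq_on_disc g (\<lambda>z. of_real t * z)" for g t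
    using linear_in_B[OF assms that] linear_deriv[OF assms that, of 0] by auto
  note Bb = B_bound[OF assms]
  have range: "?m \<le> Re (deriv g 0)" "Re (deriv g 0) \<le> ?p" if "g \<in> B (Phi c)" for g
    using between_roots[OF cc Bb(1,2)[OF that]] .
  show "\<not> eq_on_disc (g_plus c) (g_minus c)"
    using eq_on_disc_deriv[of "g_plus c" "g_minus c" 0] inB(2)[OF pos(3) root(1) refl] inB(2)[OF pos(1) root(2) refl] pos(2)
    unfolding gp gm by auto
  show "\<forall>g. g \<in> H0 \<and> locally_univalent g \<and> solves_bvp c g \<longleftrightarrow> eq_on_disc g (g_plus c) \<or> eq_on_disc g (g_minus c)"
    unfolding sol gp gm using roots_iff[OF cc] pos by blast
  show "univalent (g_plus c)" "univalent (g_minus c)"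
    unfolding gp gm
    using linear_univalent[OF assms pos(3) root(1) refl] linear_univalent[OF assms pos(1) root(2) refl] .
  show "\<forall>g. is_arg_max (\<lambda>h. Re (deriv h 0)) (\<lambda>h. h \<in> B (Phi c)) g \<longleftrightarrow> eq_on_disc g (g_plus c)"
  proof (intro allI iffI)
    fix g assume g: "is_arg_max (\<lambda>h. Re (deriv h 0)) (\<lambda>h. h \<in> B (Phi c)) g"
    then have gB: "g \<in> B (Phi c)" by (simp add: is_arg_max_def)
    have "Re (deriv (g_plus c) 0) \<le> Re (deriv g 0)"
      using g inB(1)[OF pos(3) root(1) refl] unfolding is_arg_max_def gp by (meson not_less)
    then have eq: "Re (deriv g 0) = ?p"
      using inB(2)[OF pos(3) root(1) refl] range(2)[OF gB] unfolding gp by simp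
    show "eq_on_disc g (g_plus c)" unfolding gp by (rule Bb(3)[OF gB, unfolded eq, OF root(1)])
  next
    fix g assume "eq_on_disc g (g_plus c)"
    then have g: "eq_on_disc g (\<lambda>z. of_real ?p * z)" by (simp only: gp)
    show "is_arg_max (\<lambda>h. Re (deriv h 0)) (\<lambda>h. h \<in> B (Phi c)) g"
      unfolding is_arg_max_def inB(2)[OF pos(3) root(1) g]
      using inB(1)[OF pos(3) root(1) g] range(2) by (auto simp: not_less)
  qed
  show "\<forall>g. is_arg_min (\<lambda>h. Re (deriv h 0)) (\<lambda>h. h \<in> B (Phi c)) g \<longleftrightarrow> eq_on_disc g (g_minus c)"
  proof (intro allI iffI)
    fix g assume g: "is_arg_min (\<lambda>h. Re (deriv h 0)) (\<lambda>h. h \<in> B (Phi c)) g"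
    then have gB: "g \<in> B (Phi c)" by (simp add: is_arg_min_def)
    have "Re (deriv g 0) \<le> Re (deriv (g_minus c) 0)"
      using g inB(1)[OF pos(1) root(2) refl] unfolding is_arg_min_def gm by (meson not_less)
    then have eq: "Re (deriv g 0) = ?m"
      using inB(2)[OF pos(1) root(2) refl] range(1)[OF gB] unfolding gm by simp
    show "eq_on_disc g (g_minus c)" unfolding gm by (rule Bb(3)[OF gB, unfolded eq, OF root(2)])
  next
    fix g assume "eq_on_disc g (g_minus c)"
    then have g: "eq_on_disc g (\<lambda>z. of_real ?m * z)" by (simp only: gm)
    show "is_arg_min (\<lambda>h. Re (deriv h 0)) (\<lambda>h. h \<in> B (Phi c)) g"
      unfolding is_arg_min_def inB(2)[OF pos(1) root(2) g]
      using inB(1)[OF pos(1) root(2) g] range(1) by (auto simp: not_less)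
  qed
qed

end
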